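(* For any positive integer or half-integer $m$, the number of generalized theta blocks of index $m$, counted up to multiplication by powers of $\eta$, is finite, and it equals the coefficient of $q^{2m}$ in the power series expansion of $1/\prod_{a=1}^\infty\bigl(1-q^{\varphi(a)\psi(a)}\bigr)$.
   Context: Let $\eta(\tau)=q^{1/24}\prod_{n\ge1}(1-q^n)$, $\vartheta(\tau,z)=\sum_{r\in\mathbb Z}\left(\frac{-4}{r}\right)q^{r^2/8}\zeta^{r/2}$, $q=e^{2\pi i\tau}$, $\zeta=e^{2\pi iz}$, $\vartheta_a(\tau,z)=\vartheta(\tau,az)$. A generalized theta block is a holomorphic function on $\mathbb H\times\mathbb C$ of the form $\eta^n\,\vartheta_{a_1}\cdots\vartheta_{a_r}/(\vartheta_{b_1}\cdots\vartheta_{b_s})$ with $n\in\mathbb Z$ and nonzero integers $a_j,b_j$; its index is $\frac12\bigl(\sum_i a_i^2-\sum_j b_j^2\bigr)$. Here $\varphi$ is Euler's totient function and $\psi(a)=a\prod_{p\mid a}(1+1/p)$ is the sum of all positive divisors $d$ of $a$ such that $a/d$ is squarefree.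
   Formalization: Blocks are counted up to powers of η and sign ±1: since negative a_j, b_j are allowed and ϑ_{-a} = -ϑ_a, counting only up to powers of η gives twice the stated coefficient (for m = 1/2, ϑ and -ϑ are two classes, but the coefficient of q is 1). *)

theory Defs
  imports "HOL-Analysis.Analysis" "HOL-Number_Theory.Number_Theory"
    "HOL-Computational_Algebra.Computational_Algebra"
begin

definition upper_half_plane :: "complex set" where
  "upper_half_plane = {\<tau>. Im \<tau> > 0}"

text \<open>
  Fractional powers of $q = e^{2\pi i\tau}$ and $\zeta = e^{2\pi iz}$ mean
  $q^x = e^{2\pi i x\tau}$ and $\zeta^x = e^{2\pi i x z}$.
\<close>

definition e_pow :: "complex \<Rightarrow> complex \<Rightarrow> complex" where
  "e_pow x w = exp (2 * of_real pi * \<i> * x * w)"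

definition eta :: "complex \<Rightarrow> complex" where
  "eta \<tau> = e_pow (1/24) \<tau> * (\<Prod>n. 1 - e_pow 1 \<tau> ^ Suc n)"

text \<open>The Kronecker symbol $\left(\frac{-4}{r}\right)$.\<close>

definition kronecker_m4 :: "int \<Rightarrow> complex" where
  "kronecker_m4 r = (if even r then 0 else if r mod 4 = 1 then 1 else -1)"

definition theta :: "complex \<Rightarrow> complex \<Rightarrow> complex" where
  "theta \<tau> z =
     (\<Sum>\<^sub>\<infinity>r::int. kronecker_m4 r * e_pow (of_int r ^ 2 / 8) \<tau> * e_pow (of_int r / 2) z)"

definition theta_mult :: "int \<Rightarrow> complex \<Rightarrow> complex \<Rightarrow> complex" where
  "theta_mult a \<tau> z = theta \<tau> (of_int a * z)"

text \<open>
  Holomorphy in two variables: the total derivative exists and is complex linear.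
\<close>

definition holomorphic2_on :: "(complex \<times> complex \<Rightarrow> complex) \<Rightarrow> (complex \<times> complex) set \<Rightarrow> bool" where
  "holomorphic2_on f S \<longleftrightarrow>
     (\<forall>p\<in>S. \<exists>A B. (f has_derivative (\<lambda>(u, v). A * u + B * v)) (at p))"

text \<open>
  A quotient of theta functions is a meromorphic function that may have removable
  singularities, as $\vartheta_2/\vartheta_1$ has at $z = 0$, where HOL division would give
  the value $0$. Hence ``$f$ is holomorphic and of the form
  $\eta^n \prod_j \vartheta_{a_j} / \prod_j \vartheta_{b_j}$'' is expressed
  by clearing the denominator. As that denominator vanishes only on a nowhere dense set, the
  values of $f$ on $\mathbb{H} \times \mathbb{C}$ are determined by continuity.
\<close>

definition generalized_theta_block_data ::
    "(complex \<times> complex \<Rightarrow> complex) \<Rightarrow> int \<Rightarrow> int list \<Rightarrow> int list \<Rightarrow> bool" where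
  "generalized_theta_block_data f n as bs \<longleftrightarrow>
     0 \<notin> set as \<and> 0 \<notin> set bs \<and>
     holomorphic2_on f (upper_half_plane \<times> UNIV) \<and>
     (\<forall>\<tau>\<in>upper_half_plane. \<forall>z.
        f (\<tau>, z) * (\<Prod>b\<leftarrow>bs. theta_mult b \<tau> z) =
        eta \<tau> powi n * (\<Prod>a\<leftarrow>as. theta_mult a \<tau> z))"

definition theta_block_index :: "int list \<Rightarrow> int list \<Rightarrow> rat" where
  "theta_block_index as bs = of_int ((\<Sum>a\<leftarrow>as. a\<^sup>2) - (\<Sum>b\<leftarrow>bs. b\<^sup>2)) / 2"

definition generalized_theta_blocks :: "rat \<Rightarrow> (complex \<times> complex \<Rightarrow> complex) set" where
  "generalized_theta_blocks m =
     {f. \<exists>n as bs. generalized_theta_block_data f n as bs \<and> theta_block_index as bs = m}"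

text \<open>
  Equality on $\mathbb{H} \times \mathbb{C}$ up to multiplication by a power of $\eta$ and a
  sign. The sign is necessary because $\vartheta_{-a} = -\vartheta_a$: since negative $a_j$
  and $b_j$ are allowed, $-f$ is a generalized theta block whenever $f$ is one of positive
  index, although $-1$ is not a power of $\eta$. As the functions are total in HOL, the
  relation also identifies functions that differ only outside $\mathbb{H} \times \mathbb{C}$.
\<close>

definition eta_power_rel ::
    "((complex \<times> complex \<Rightarrow> complex) \<times> (complex \<times> complex \<Rightarrow> complex)) set" where
  "eta_power_rel =
     {(f, g). \<exists>k::int. \<exists>s\<in>{1, -1}. \<forall>\<tau>\<in>upper_half_plane. \<forall>z.
        g (\<tau>, z) = s * eta \<tau> powi k * f (\<tau>, z)}"

text \<open>
  The integer-valued form of $\psi(a) = a \prod_{p \mid a} (1 + 1/p)$; the product formula is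
  proved below.
\<close>

definition dedekind_psi :: "nat \<Rightarrow> nat" where
  "dedekind_psi a = (\<Sum>d | d dvd a \<and> squarefree (a div d). d)"

lemma dedekind_psi_conv_prod:
  assumes "a > 0"
  shows   "(of_nat (dedekind_psi a) :: rat) = of_nat a * (\<Prod>p\<in>prime_factors a. 1 + 1 / of_nat p)"
proof -
  let ?P = "prime_factors a"
  have prime: "prime p" if "p \<in> ?P" for p using that by auto
  have dvd: "\<Prod>S dvd a" if "S \<subseteq> ?P" for S
  proof -
    have "\<Prod>S dvd \<Prod>?P" using that by (intro prod_dvd_prod_subset) auto
    also have "\<Prod>?P dvd (\<Prod>p\<in>?P. p ^ multiplicity p a)"
      using assms by (intro prod_dvd_prod dvd_power)
        (auto simp: prime_factors_multiplicity)
    also have "\<dots> = a" using assms by (metis prod_prime_factors normalize_nat_def not_gr_zero id_apply)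
    finally show ?thesis .
  qed
  have pf: "prime_factors (\<Prod>S) = S" if "S \<subseteq> ?P" for S
  proof -
    have fin: "finite S" using that finite_subset by blast
    have nz: "0 \<notin> S" using that assms by (auto dest: prime)
    have "prime_factors (\<Prod>S) = \<Union>(prime_factors ` S)"
      using fin nz by (subst prime_factors_prod) auto
    also have "\<dots> = (\<Union>p\<in>S. {p})"
      using that prime by (intro SUP_cong refl) (simp add: prime_prime_factors subset_iff)
    also have "\<dots> = S" by simp
    finally show ?thesis .
  qed
  have sqf: "squarefree (\<Prod>S)" if "S \<subseteq> ?P" for S
    using that by (intro squarefree_prod_coprime)
      (auto simp: subset_iff intro!: primes_coprime squarefree_prime)
  have eq: "\<Prod>(prime_factors e) = e" if "squarefree e" for e :: nat
  proof -
    have nz: "e \<noteq> 0" using that by (metis not_squarefree_0)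
    have "(\<Prod>p\<in>prime_factors e. p) = (\<Prod>p\<in>prime_factors e. p ^ multiplicity p e)"
      using that squarefree_factorial_semiring'[OF nz] by (intro prod.cong refl) simp
    also have "\<dots> = e" using nz by (metis prod_prime_factors normalize_nat_def id_apply)
    finally show ?thesis by simp
  qed
  have "(of_nat (dedekind_psi a) :: rat) =
          (\<Sum>d | d dvd a \<and> squarefree (a div d). of_nat d)"
    by (simp add: dedekind_psi_def)
  also have "\<dots> = (\<Sum>S\<in>Pow ?P. of_nat (a div \<Prod>S))"
  proof (rule sum.reindex_bij_witness[of _ "\<lambda>S. a div \<Prod>S" "\<lambda>d. prime_factors (a div d)"])
    fix d assume d: "d \<in> {d. d dvd a \<and> squarefree (a div d)}"
    then have *: "\<Prod>(prime_factors (a div d)) = a div d" "a div d dvd a" "a div (a div d) = d"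
      using assms by (auto simp: eq div_dvd_iff_mult div_div_eq_right)
    show "a div \<Prod>(prime_factors (a div d)) = d" using * by simp
    then show "of_nat (a div \<Prod>(prime_factors (a div d))) = (of_nat d :: rat)" by simp
    show "prime_factors (a div d) \<in> Pow ?P"
      using * assms by (simp add: dvd_prime_factors)
  next
    fix S assume S: "S \<in> Pow ?P"
    then have *: "\<Prod>S dvd a" "a div (a div \<Prod>S) = \<Prod>S" "a div \<Prod>S dvd a"
      using assms dvd[of S] by (auto simp: div_div_eq_right div_dvd_iff_mult)
    show "prime_factors (a div (a div \<Prod>S)) = S" using S pf * by simp
    show "a div \<Prod>S \<in> {d. d dvd a \<and> squarefree (a div d)}" using S sqf * by simp
  qed
  also have "\<dots> = (\<Sum>S\<in>Pow ?P. of_nat a * (\<Prod>p\<in>S. 1 / of_nat p))"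
  proof (intro sum.cong refl)
    fix S assume "S \<in> Pow ?P"
    then obtain c where c: "a = \<Prod>S * c" using dvd[of S] by (auto simp: dvd_def)
    then have "\<Prod>S \<noteq> 0" "c = a div \<Prod>S" using assms by auto
    then have "of_nat a = of_nat (\<Prod>S) * (of_nat (a div \<Prod>S) :: rat)"
      using c by (metis of_nat_mult)
    then show "of_nat (a div \<Prod>S) = (of_nat a :: rat) * (\<Prod>p\<in>S. 1 / of_nat p)"
      using \<open>\<Prod>S \<noteq> 0\<close> by (simp add: prod_dividef flip: of_nat_prod)
  qed
  also have "\<dots> = of_nat a * (\<Prod>p\<in>?P. 1 / of_nat p + 1)"
    by (subst prod_add) (auto simp: sum_distrib_left)
  finally show ?thesis by (simp add: add.commute)
qed

end

theory Submission
  imports Defs "HOL-Complex_Analysis.Complex_Analysis"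
begin

text \<open>
  For fixed $\tau$ the zeros of $\vartheta(\tau,\cdot)$ are simple and form the lattice
  $\mathbb{Z}\tau + \mathbb{Z}$; this comes out of the Jacobi triple product. So $\vartheta_a$
  has a simple zero at a torsion point of exact order $d$ if $d \mid a$ and no zero there otherwise,
  and a quotient of theta functions has the order
  $\nu(d) = \#\{i : d \mid a_i\} - \#\{j : d \mid b_j\}$ at such a point. The quotient is
  holomorphic iff $\nu \ge 0$, up to powers of $\eta$ and signs it is determined by $\nu$, and every
  finitely supported $\nu \ge 0$ occurs. As $\sum_{d \mid a} \varphi(d)\psi(d) = a^2$, twice the
  index is $\sum_d \varphi(d)\psi(d)\nu(d)$, so the blocks of index $m$ correspond to the
  partitions of $2m$ into parts $\varphi(d)\psi(d)$, each labelled by its $d$.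
\<close>

section \<open>Divisor sums and the generating function\<close>

text \<open>The weight \<phi>(d)\<psi>(d) is Jordan's totient J_2(d), the number of points of exact
  order d on the torus of \<tau>. So its sum over d | a counts the a^2 zeros of the a-th theta
  factor modulo the lattice, and 2m is the number of zeros of a block of index m in one slice, again
  modulo the lattice. Two obstacles shape the proof. Divisors are read off with \<tau> fixed,
  whereas a block has to be holomorphic in both variables jointly. Filling the removable
  singularities slice by slice gives no control in \<tau>; that control is regained through a Cauchy
  integral in z. Moreover, an equation with cleared denominators determines a block only where the
  denominator is nonzero, so comparisons are made on punctured neighbourhoods and extended by
  continuity. To recover \<nu>(d) the single point 1/d is enough, since it has exact order d for
  every \<tau>. The triple product enters only through a lower bound for theta in a strip; this
  bound gives location and simplicity of the zeros without counting them by contour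
  integration.\<close>

lemma totient_dedekind_psi:
  assumes "a > 0"
  shows "real (totient a * dedekind_psi a) = real a ^ 2 * (\<Prod>p\<in>prime_factors a. 1 - 1 / real p ^ 2)"
proof -
  have "real (dedekind_psi a) = of_rat (of_nat (dedekind_psi a))"
    by simp
  also have "\<dots> = real a * (\<Prod>p\<in>prime_factors a. 1 + 1 / real p)"
    by (subst dedekind_psi_conv_prod[OF assms]) (simp add: of_rat_mult of_rat_prod of_rat_add of_rat_divide)
  finally have "real (totient a * dedekind_psi a) =
      real a ^ 2 * (\<Prod>p\<in>prime_factors a. (1 - 1 / real p) * (1 + 1 / real p))"
    by (simp add: totient_formula2 prod.distrib power2_eq_square mult_ac)
  also have "(\<Prod>p\<in>prime_factors a. (1 - 1 / real p) * (1 + 1 / real p)) =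
      (\<Prod>p\<in>prime_factors a. 1 - 1 / real p ^ 2)"
    by (intro prod.cong) (simp_all add: algebra_simps power2_eq_square)
  finally show ?thesis .
qed

lemma totient_dedekind_psi_mult_coprime:
  assumes "coprime a b" "a > 0" "b > 0"
  shows "totient (a * b) * dedekind_psi (a * b) =
    (totient a * dedekind_psi a) * (totient b * dedekind_psi b)"
proof -
  have disj: "prime_factors a \<inter> prime_factors b = {}"
  proof -
    have False if "p \<in> prime_factors a" "p \<in> prime_factors b" for p
    proof -
      have "p dvd a" "p dvd b" "prime p" using that by auto
      then show False using assms(1) coprime_common_divisor not_prime_unit by blast
    qed
    then show ?thesis by blast
  qed
  have "real (totient (a * b) * dedekind_psi (a * b)) =
    real ((totient a * dedekind_psi a) * (totient b * dedekind_psi b))"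
    unfolding of_nat_mult[of "totient a * dedekind_psi a"]
    using assms disj by (subst (1 2 3) totient_dedekind_psi)
      (simp_all add: prime_factors_product prod.union_disjoint power_mult_distrib)
  then show ?thesis
    by (simp only: of_nat_eq_iff)
qed

text \<open>A divisor of \<open>a * b\<close> is recovered from its gcds with \<open>a\<close> and
  \<open>b\<close>. Multiplicativity of \<open>g\<close> is asked only on such pairs of divisors
  because the intended weight is multiplicative only for coprime arguments.\<close>

lemma sum_divisors_mult_coprime:
  fixes g :: "nat \<Rightarrow> nat"
  assumes "coprime a b" "a > 0" "b > 0"
    and "\<And>d e. d dvd a \<Longrightarrow> e dvd b \<Longrightarrow> g (d * e) = g d * g e"
  shows "(\<Sum>d | d dvd a * b. g d) = (\<Sum>d | d dvd a. g d) * (\<Sum>d | d dvd b. g d)"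
proof -
  have "(\<Sum>d | d dvd a. g d) * (\<Sum>d | d dvd b. g d) =
      (\<Sum>(d, e) \<in> {d. d dvd a} \<times> {e. e dvd b}. g (d * e))"
    unfolding sum_product sum.cartesian_product using assms by (intro sum.cong) auto
  also have "\<dots> = (\<Sum>d | d dvd a * b. g d)"
  proof -
    have gcd_eq: "gcd (d * e) a = d" "gcd (d * e) b = e" if "d dvd a" "e dvd b" for d e
    proof -
      have 1: "coprime e a" using that assms by (meson coprime_commute coprime_divisors dvd_refl)
      have 2: "coprime d b" using that assms by (meson coprime_divisors dvd_refl)
      show "gcd (d * e) a = d" using 1 that
        by (simp add: gcd_mult_left_right_cancel coprime_commute gcd_nat.absorb1)
      show "gcd (d * e) b = e" using 2 that
        by (simp add: gcd_mult_left_left_cancel coprime_commute gcd_nat.absorb1)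
    qed
    show ?thesis
    proof (rule sum.reindex_bij_witness[of _ "\<lambda>d. (gcd d a, gcd d b)" "\<lambda>(d, e). d * e"])
      fix x assume "x \<in> {d. d dvd a} \<times> {e. e dvd b}"
      then obtain d e where x: "x = (d, e)" "d dvd a" "e dvd b" by auto
      show "(gcd (case x of (d, e) \<Rightarrow> d * e) a, gcd (case x of (d, e) \<Rightarrow> d * e) b) = x"
        using x gcd_eq by simp
    next
      fix d assume "d \<in> {d. d dvd a * b}"
      then obtain x y where "d = x * y" "x dvd a" "y dvd b"
        using division_decomp by blast
      then show "(case (gcd d a, gcd d b) of (d, e) \<Rightarrow> d * e) = d"
        using gcd_eq by simp
    qed (auto intro: mult_dvd_mono)
  qed
  finally show ?thesis ..
qed

text \<open>Both sides are multiplicative, so the induction splits off the full power of one prime;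
  on prime powers the divisor sum telescopes.\<close>

lemma sum_divisors_totient_dedekind_psi:
  assumes "a > 0"
  shows "(\<Sum>d | d dvd a. totient d * dedekind_psi d) = a ^ 2"
  using assms
proof (induction a rule: less_induct)
  case (less a)
  define J where "J d = totient d * dedekind_psi d" for d
  show ?case
  proof (cases "a = 1")
    case True
    have "{d. d = Suc 0 \<and> squarefree (Suc 0 div d)} = {Suc 0}" by auto
    then show ?thesis using True by (simp add: dedekind_psi_def)
  next
    case False
    then obtain p where p: "prime p" "p dvd a"
      using prime_factor_nat by blast
    define k where "k = multiplicity p a"
    have k: "k > 0"
      using p less.prems by (simp add: k_def prime_multiplicity_gt_zero_iff)
    obtain m where m: "a = p ^ k * m" "\<not> p dvd m"
      using multiplicity_decompose'[of a p] p less.prems not_prime_unit[of p]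
      unfolding k_def by blast
    have cop: "coprime (p ^ k) m"
      using m(2) p by (simp add: prime_imp_coprime)
    have pos: "m > 0" "p ^ k > 0" using m less.prems by auto
    have "1 < p ^ k"
      by (intro one_less_power prime_gt_1_nat p k)
    then have "m < a" using m pos by simp
    \<comment> \<open>Only the factor 1 - 1/p^2 of the product formula survives. Written as a
      difference of consecutive even powers it telescopes; the reals avoid truncated
      subtraction.\<close>
    have Jpow: "real (J (p ^ Suc i)) = real p ^ (2 * Suc i) - real p ^ (2 * i)" for i
    proof -
      have "prime_factors (p ^ Suc i) = {p}"
        using p by (metis prime_factors_power prime_prime_factors zero_less_Suc)
      then show ?thesis
        unfolding J_def using p prime_gt_0_nat[OF p(1)]
        by (subst totient_dedekind_psi) (auto simp: field_simps power_mult power2_eq_square)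
    qed
    have "(\<Sum>d | d dvd p ^ k. J d) = (\<Sum>i\<le>k. J (p ^ i))"
    proof (rule sum.reindex_bij_witness[of _ "\<lambda>i. p ^ i" "multiplicity p"])
      fix d assume "d \<in> {d. d dvd p ^ k}"
      then obtain i where "i \<le> k" "d = p ^ i"
        using divides_primepow_nat[OF p(1)] by auto
      then show "p ^ multiplicity p d = d" "multiplicity p d \<in> {..k}" "J (p ^ multiplicity p d) = J d"
        using p(1) by (auto simp: multiplicity_same_power not_prime_unit prime_gt_0_nat)
    next
      fix i assume "i \<in> {..k}"
      then show "multiplicity p (p ^ i) = i" "p ^ i \<in> {d. d dvd p ^ k}"
        using p(1) prime_gt_0_nat by (auto simp: le_imp_power_dvd multiplicity_same_power not_prime_unit)
    qed
    moreover have "real (\<Sum>i\<le>n. J (p ^ i)) = real p ^ (2 * n)" for n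
    proof (induction n)
      case 0
      have "{d. d = Suc 0 \<and> squarefree (Suc 0 div d)} = {Suc 0}" by auto
      then show ?case by (simp add: J_def dedekind_psi_def)
    next
      case (Suc n)
      have "real (\<Sum>i\<le>Suc n. J (p ^ i)) = real (\<Sum>i\<le>n. J (p ^ i)) + real (J (p ^ Suc n))"
        by simp
      then show ?case unfolding Suc Jpow by simp
    qed
    ultimately have "real (\<Sum>d | d dvd p ^ k. J d) = real ((p ^ k) ^ 2)"
      by (simp only: power_mult[symmetric] mult.commute[of k 2] of_nat_power)
    then have 1: "(\<Sum>d | d dvd p ^ k. J d) = (p ^ k) ^ 2"
      by (simp only: of_nat_eq_iff)
    have 2: "(\<Sum>d | d dvd m. J d) = m ^ 2"
      using less.IH[OF \<open>m < a\<close> pos(1)] by (simp add: J_def)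
    have "(\<Sum>d | d dvd p ^ k * m. J d) = (\<Sum>d | d dvd p ^ k. J d) * (\<Sum>d | d dvd m. J d)"
    proof (rule sum_divisors_mult_coprime[OF cop pos(2,1)])
      fix d e assume de: "d dvd p ^ k" "e dvd m"
      have "coprime d e" using cop by (rule coprime_divisors[OF de])
      moreover have "d > 0" "e > 0"
        using dvd_pos_nat[OF pos(2) de(1)] dvd_pos_nat[OF pos(1) de(2)] by blast+
      ultimately show "J (d * e) = J d * J e"
        unfolding J_def by (rule totient_dedekind_psi_mult_coprime)
    qed
    then show ?thesis
      unfolding 1 2 m(1)[symmetric] power_mult_distrib[symmetric] by (simp only: J_def)
  qed
qed

text \<open>\<open>a\<close> is among the divisors summed in \<open>dedekind_psi a\<close>, as
  \<open>a div a\<close> is squarefree. This growth makes the infinite product converge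
  coefficientwise and bounds the labels that occur in a given weight.\<close>

lemma le_totient_dedekind_psi:
  assumes "a > 0"
  shows "a \<le> totient a * dedekind_psi a"
proof -
  have "a \<le> dedekind_psi a"
    unfolding dedekind_psi_def using assms
    by (intro member_le_sum) auto
  also have "\<dots> \<le> totient a * dedekind_psi a"
    using assms by (simp add: Suc_le_eq)
  finally show ?thesis .
qed

section \<open>Partitions with labelled parts and their generating function\<close>

text \<open>Multiplicity functions of partitions of \<open>k\<close> into parts of size
  \<open>c a\<close> with label \<open>a\<close>; equal sizes with different labels stay distinct.
  Forcing 0 outside \<open>{1..N}\<close> makes equal partitions equal as functions.\<close>

definition weighted_compositions :: "(nat \<Rightarrow> nat) \<Rightarrow> nat \<Rightarrow> nat \<Rightarrow> (nat \<Rightarrow> nat) set" where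
  "weighted_compositions c N k =
     {\<nu>. (\<forall>a. a \<notin> {1..N} \<longrightarrow> \<nu> a = 0) \<and> (\<Sum>a=1..N. c a * \<nu> a) = k}"

lemma finite_weighted_compositions:
  assumes "\<And>a. a > 0 \<Longrightarrow> c a > 0"
  shows "finite (weighted_compositions c N k)"
proof (rule finite_subset)
  show "weighted_compositions c N k \<subseteq>
      {\<nu>. \<forall>a. (a \<in> {1..N} \<longrightarrow> \<nu> a \<in> {..k}) \<and> (a \<notin> {1..N} \<longrightarrow> \<nu> a = 0)}"
  proof (clarsimp simp: weighted_compositions_def)
    fix \<nu> a assume a: "Suc 0 \<le> a" "a \<le> N"
    have "\<nu> a \<le> c a * \<nu> a" using assms[of a] a by simp
    also have "\<dots> \<le> (\<Sum>a=1..N. c a * \<nu> a)"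
      using a by (intro member_le_sum) auto
    finally show "\<nu> a \<le> (\<Sum>a = Suc 0..N. c a * \<nu> a)" by simp
  qed
  show "finite {\<nu>. \<forall>a. (a \<in> {1..N} \<longrightarrow> \<nu> a \<in> {..k}) \<and> (a \<notin> {1..N} \<longrightarrow> \<nu> a = 0)}"
    by (intro finite_set_of_finite_funs) auto
qed

text \<open>A label \<open>a > k\<close> of nonzero multiplicity would contribute at least
  \<open>c a\<close>, hence more than \<open>k\<close>, on its own.\<close>

lemma weighted_compositions_extend:
  assumes "\<And>a. a > 0 \<Longrightarrow> c a \<ge> a" "k \<le> N"
  shows "weighted_compositions c N k = weighted_compositions c k k"
proof -
  have zero1: "\<nu> a = 0" if "\<nu> \<in> weighted_compositions c N k" "a > k" for \<nu> a
  proof (rule ccontr)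
    assume "\<nu> a \<noteq> 0"
    then have a: "a \<in> {1..N}" using that by (auto simp: weighted_compositions_def)
    have "k < c a"
      using assms(1)[of a] that(2) a by simp
    also have "\<dots> \<le> c a * \<nu> a"
      using \<open>\<nu> a \<noteq> 0\<close> by simp
    also have "\<dots> \<le> (\<Sum>a=1..N. c a * \<nu> a)"
      using a by (intro member_le_sum) auto
    finally show False using that by (simp add: weighted_compositions_def)
  qed
  have sum_eq: "(\<Sum>a=1..N. c a * \<nu> a) = (\<Sum>a=1..k. c a * \<nu> a)" if "\<And>a. a > k \<Longrightarrow> \<nu> a = 0" for \<nu> :: "nat \<Rightarrow> nat"
    using assms(2) that by (intro sum.mono_neutral_right) auto
  have zero2: "\<nu> a = 0" if "\<nu> \<in> weighted_compositions c k k" "a > k" for \<nu> a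
    using that by (simp add: weighted_compositions_def)
  have supp_eq: "(\<forall>a. a \<notin> {1..N} \<longrightarrow> \<nu> a = 0) \<longleftrightarrow> (\<forall>a. a \<notin> {1..k} \<longrightarrow> \<nu> a = 0)"
    if "\<And>a. a > k \<Longrightarrow> \<nu> a = 0" for \<nu> :: "nat \<Rightarrow> nat"
    using that assms(2) by (auto simp: not_le)
  have "\<nu> \<in> weighted_compositions c N k \<longleftrightarrow> \<nu> \<in> weighted_compositions c k k" for \<nu>
  proof (cases "\<forall>a>k. \<nu> a = 0")
    case True
    then show ?thesis
      using sum_eq[of \<nu>] supp_eq[of \<nu>] by (simp add: weighted_compositions_def)
  next
    case False
    then show ?thesis using zero1[of \<nu>] zero2[of \<nu>] by blast
  qed
  then show ?thesis by blast
qed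

text \<open>Either the label \<open>Suc N\<close> is absent or one copy of it can be taken away.
  This is multiplication of the generating function by \<open>1 - fps_X ^ c (Suc N)\<close>, read
  off coefficientwise.\<close>

lemma card_weighted_compositions_Suc:
  assumes "\<And>a. a > 0 \<Longrightarrow> c a > 0"
  shows "card (weighted_compositions c (Suc N) k) =
     card (weighted_compositions c N k) +
     (if k < c (Suc N) then 0 else card (weighted_compositions c (Suc N) (k - c (Suc N))))"
proof -
  let ?W = "weighted_compositions c" and ?b = "\<lambda>\<nu>. \<nu>(Suc N := Suc (\<nu> (Suc N)))"
  let ?R = "if k < c (Suc N) then {} else ?b ` ?W (Suc N) (k - c (Suc N))"
  have sumb: "(\<Sum>a=1..Suc N. c a * ?b \<nu> a) = (\<Sum>a=1..Suc N. c a * \<nu> a) + c (Suc N)" for \<nu>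
    by simp
  have split: "?W (Suc N) k = ?W N k \<union> ?R"
  proof (intro equalityI subsetI)
    fix \<nu> assume \<nu>: "\<nu> \<in> ?W (Suc N) k"
    show "\<nu> \<in> ?W N k \<union> ?R"
    proof (cases "\<nu> (Suc N) = 0")
      case True
      then have "\<forall>a. a \<notin> {1..N} \<longrightarrow> \<nu> a = 0"
        using \<nu> by (auto simp: weighted_compositions_def le_Suc_eq)
      then show ?thesis using \<nu> True by (auto simp: weighted_compositions_def)
    next
      case False
      define \<nu>' where "\<nu>' = \<nu>(Suc N := \<nu> (Suc N) - 1)"
      have eq: "\<nu> = ?b \<nu>'" using False by (auto simp: \<nu>'_def fun_eq_iff)
      have "(\<Sum>a=1..Suc N. c a * \<nu>' a) + c (Suc N) = k"
        using \<nu> unfolding sumb[symmetric] eq[symmetric] by (simp add: weighted_compositions_def)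
      moreover have "\<forall>a. a \<notin> {1..Suc N} \<longrightarrow> \<nu>' a = 0"
        using \<nu> by (auto simp: weighted_compositions_def \<nu>'_def)
      ultimately have "\<nu>' \<in> ?W (Suc N) (k - c (Suc N))" "\<not> k < c (Suc N)"
        by (auto simp: weighted_compositions_def)
      then show ?thesis using eq by auto
    qed
  next
    fix \<nu> assume "\<nu> \<in> ?W N k \<union> ?R"
    then show "\<nu> \<in> ?W (Suc N) k"
    proof
      assume "\<nu> \<in> ?W N k"
      then show ?thesis by (auto simp: weighted_compositions_def)
    next
      assume "\<nu> \<in> ?R"
      then obtain \<nu>' where k: "\<not> k < c (Suc N)" and \<nu>': "\<nu>' \<in> ?W (Suc N) (k - c (Suc N))" "\<nu> = ?b \<nu>'"
        by (auto split: if_splits)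
      then have "(\<Sum>a=1..Suc N. c a * \<nu> a) = k"
        unfolding \<nu>'(2) sumb by (simp add: weighted_compositions_def)
      moreover have "\<forall>a. a \<notin> {1..Suc N} \<longrightarrow> \<nu> a = 0"
        using \<nu>' by (auto simp: weighted_compositions_def)
      ultimately show ?thesis by (simp add: weighted_compositions_def)
    qed
  qed
  have "\<nu> (Suc N) = 0" if "\<nu> \<in> ?W N k" for \<nu>
    using that by (simp add: weighted_compositions_def)
  moreover have "\<nu> (Suc N) \<noteq> 0" if "\<nu> \<in> ?R" for \<nu>
    using that by (auto split: if_splits)
  ultimately have disj: "?W N k \<inter> ?R = {}"
    by blast
  have inj: "inj_on ?b A" for A
  proof (rule inj_onI)
    fix f g assume eq: "?b f = ?b g"
    show "f = g"
    proof
      fix x show "f x = g x" using fun_cong[OF eq, of x] by (cases "x = Suc N") auto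
    qed
  qed
  have fin: "finite (?W N k)" "finite ?R"
    using finite_weighted_compositions[of c] assms by auto
  have "card (?W (Suc N) k) = card (?W N k) + card ?R"
    unfolding split by (rule card_Un_disjoint[OF fin disj])
  then show ?thesis
    using inj by (simp add: card_image)
qed

lemma prod_times_weighted_compositions_fps:
  assumes "\<And>a. a > 0 \<Longrightarrow> c a > 0"
  shows "(\<Prod>n<N. 1 - fps_X ^ c (Suc n)) *
     Abs_fps (\<lambda>k. of_nat (card (weighted_compositions c N k))) = (1 :: rat fps)"
proof (induction N)
  case 0
  have "weighted_compositions c 0 k = (if k = 0 then {\<lambda>_. 0} else {})" for k
    by (auto simp: weighted_compositions_def)
  then show ?case by (auto simp: fps_eq_iff)
next
  case (Suc N)
  let ?F = "\<lambda>N. Abs_fps (\<lambda>k. of_nat (card (weighted_compositions c N k))) :: rat fps"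
  have "(1 - fps_X ^ c (Suc N)) * ?F (Suc N) = ?F N"
    by (rule fps_ext) (use card_weighted_compositions_Suc[of c] assms in \<open>simp add: ring_distribs fps_X_power_mult_nth\<close>)
  then show ?case using Suc by (simp add: mult.assoc)
qed

text \<open>Since \<open>c a\<close> is at least \<open>a\<close>, the factor with index
  \<open>n\<close> does not touch coefficients below degree \<open>Suc n\<close>. Hence every
  coefficient of the partial products, and of their inverses, becomes stationary.\<close>

lemma fps_nth_inverse_prodinf:
  fixes c :: "nat \<Rightarrow> nat"
  assumes c: "\<And>a. a > 0 \<Longrightarrow> c a \<ge> a"
  shows "fps_nth (1 / (\<Prod>n. 1 - fps_X ^ c (Suc n)) :: rat fps) k =
     of_nat (card (weighted_compositions c k k))"
proof -
  let ?f = "\<lambda>n. 1 - fps_X ^ c (Suc n) :: rat fps"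
  have c0: "c (Suc n) > 0" for n
    using c[of "Suc n"] by simp
  have nth0: "fps_nth (?f n) 0 = 1" for n
    using c0[of n] by simp
  have nz: "?f n \<noteq> 0" for n
    using nth0[of n] by (metis fps_zero_nth zero_neq_one)
  \<comment> \<open>Diagonal candidate for the limit: coefficient \<open>n\<close> no longer changes
    after the factor with index \<open>n\<close>.\<close>
  define P where "P = Abs_fps (\<lambda>n. fps_nth (\<Prod>i\<le>n. ?f i) n)"
  have stable: "fps_nth (\<Prod>i\<le>N. ?f i) n = fps_nth P n" if "N \<ge> n" for N n
    using that
  proof (induction N rule: dec_induct)
    case base
    then show ?case by (simp add: P_def)
  next
    case (step N)
    have "n < c (Suc (Suc N))" using c[of "Suc (Suc N)"] step by simp
    then show ?case using step by (simp add: ring_distribs fps_X_power_mult_right_nth)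
  qed
  have P: "(\<lambda>n. \<Prod>i\<le>n. ?f i) \<longlonglongrightarrow> P"
    by (intro tendsto_fpsI eventually_sequentiallyI[OF stable])
  have "fps_nth P 0 = 1"
  proof -
    have "fps_nth (\<Prod>i\<le>0. ?f i) 0 = fps_nth P 0"
      by (rule stable) simp
    then show ?thesis using nth0[of 0] by simp
  qed
  then have P0: "P \<noteq> 0" "fps_nth P 0 \<noteq> 0" by auto
  \<comment> \<open>The constant coefficient 1 provides the nonzero limit that
    \<open>raw_has_prod\<close> demands.\<close>
  then have "?f has_prod P"
    using P by (auto simp: has_prod_def raw_has_prod_def)
  then have P_eq: "(\<Prod>n. ?f n) = P"
    using has_prod_unique by blast
  have inv: "inverse (\<Prod>n<N. ?f n) = Abs_fps (\<lambda>k. of_nat (card (weighted_compositions c N k)))" for N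
    using prod_times_weighted_compositions_fps[of c N] c
    by (metis fps_inverse_unique le_zero_eq neq0_conv)
  have "(\<lambda>n. inverse (\<Prod>i\<le>n. ?f i)) \<longlonglongrightarrow> inverse P"
    using P P0 by (intro tendsto_inverse_fps) auto
  then have "\<forall>\<^sub>F n in sequentially. fps_nth (inverse (\<Prod>i\<le>n. ?f i)) k = fps_nth (inverse P) k"
    unfolding tendsto_fps_iff by blast
  \<comment> \<open>Convergence of power series means that each coefficient is eventually equal to
    that of the limit, so one sufficiently large partial product decides coefficient
    \<open>k\<close>.\<close>
  then obtain n where n: "n \<ge> k" "fps_nth (inverse (\<Prod>i\<le>n. ?f i)) k = fps_nth (inverse P) k"
    unfolding eventually_sequentially by (meson nat_le_linear)
  have "fps_nth (inverse P) k = of_nat (card (weighted_compositions c (Suc n) k))"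
    using n(2) inv[of "Suc n"] by (simp add: lessThan_Suc_atMost)
  also have "weighted_compositions c (Suc n) k = weighted_compositions c k k"
    using n(1) c by (intro weighted_compositions_extend) auto
  finally show ?thesis
    unfolding P_eq using P0 by (simp add: fps_divide_unit)
qed

section \<open>The theta series\<close>

lemma e_pow_add: "e_pow (x + y) w = e_pow x w * e_pow y w"
  by (simp add: e_pow_def exp_add ring_distribs)

lemma e_pow_add_right: "e_pow x (w + w') = e_pow x w * e_pow x w'"
  by (simp add: e_pow_def exp_add ring_distribs)

lemma e_pow_0 [simp]: "e_pow 0 w = 1"
  by (simp add: e_pow_def)

lemma e_pow_nonzero [simp]: "e_pow x w \<noteq> 0"
  by (simp add: e_pow_def)

lemma e_pow_minus: "e_pow (-x) w = inverse (e_pow x w)"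
  by (simp add: e_pow_def exp_minus)

lemma e_pow_of_nat_mult: "e_pow (of_nat n * x) w = e_pow x w ^ n"
  by (simp add: e_pow_def exp_of_nat_mult [symmetric] mult_ac)

lemma norm_e_pow_of_real: "norm (e_pow (of_real x) w) = exp (- (2 * pi * x * Im w))"
  by (simp add: e_pow_def)

lemma norm_e_pow: "Im x = 0 \<Longrightarrow> norm (e_pow x w) = exp (- (2 * pi * Re x * Im w))"
  using norm_e_pow_of_real[of "Re x" w] by (simp add: complex_eq_iff e_pow_def)

lemma kronecker_m4_add2: "kronecker_m4 (r + 2) = - kronecker_m4 r"
proof -
  have "(r + 2) mod 4 = 1 \<longleftrightarrow> r mod 4 \<noteq> 1" if "odd r"
    using that by presburger
  then show ?thesis by (auto simp: kronecker_m4_def)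
qed

lemma theta_add_1: "theta \<tau> (z + 1) = - theta \<tau> z"
proof -
  have 1: "kronecker_m4 r * e_pow (of_int r ^ 2 / 8) \<tau> * e_pow (of_int r / 2) (z + 1) =
     - (kronecker_m4 r * e_pow (of_int r ^ 2 / 8) \<tau> * e_pow (of_int r / 2) z)" for r
  proof (cases "even r")
    case True
    then show ?thesis by (simp add: kronecker_m4_def)
  next
    case False
    then obtain k where k: "r = 2 * k + 1" by (elim oddE)
    have "e_pow (of_int r / 2) 1 = exp (\<i> * of_real pi + (2 * of_int k * of_real pi) * \<i>)"
      unfolding e_pow_def by (rule arg_cong[of _ _ exp]) (simp add: k field_simps)
    also have "\<dots> = exp (\<i> * of_real pi) * exp ((2 * of_int k * of_real pi) * \<i>)"
      by (rule exp_add)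
    also have "exp ((2 * of_int k * of_real pi) * \<i>) = 1"
      using exp_integer_2pi[of "of_int k"] by (simp add: mult_ac)
    finally have "e_pow (of_int r / 2) 1 = -1" by simp
    then show ?thesis by (simp add: e_pow_add_right)
  qed
  show ?thesis
    unfolding theta_def 1 by (rule infsum_uminus)
qed

text \<open>Completing the square: the translation multiplies the term of index \<open>r\<close> by
  q^(r/2), which turns it into the term of index \<open>r + 2\<close> up to a factor independent of
  \<open>r\<close>. The sign is that of the Kronecker symbol.\<close>

lemma theta_add_tau: "theta \<tau> (z + \<tau>) = - (e_pow (-1/2) \<tau> * e_pow (-1) z) * theta \<tau> z"
proof -
  let ?f = "\<lambda>r z. kronecker_m4 r * e_pow (of_int r ^ 2 / 8) \<tau> * e_pow (of_int r / 2) z"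
  have "?f r (z + \<tau>) = - (e_pow (-1/2) \<tau> * e_pow (-1) z) * ?f (r + 2) z" for r
  proof -
    have 1: "of_int (r + 2) ^ 2 / 8 = of_int r ^ 2 / 8 + of_int r / 2 + (1/2 :: complex)"
      by (simp add: power2_eq_square field_simps)
    have 2: "of_int (r + 2) / 2 = of_int r / 2 + (1 :: complex)"
      by simp
    show ?thesis
      unfolding kronecker_m4_add2 1 2 e_pow_add e_pow_add_right
      by (simp add: e_pow_minus field_simps)
  qed
  then have "theta \<tau> (z + \<tau>) = (\<Sum>\<^sub>\<infinity>r. - (e_pow (-1/2) \<tau> * e_pow (-1) z) * ?f (r + 2) z)"
    unfolding theta_def by simp
  also have "\<dots> = - (e_pow (-1/2) \<tau> * e_pow (-1) z) * (\<Sum>\<^sub>\<infinity>r. ?f (r + 2) z)"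
    by (rule infsum_cmult_right')
  also have "(\<Sum>\<^sub>\<infinity>r. ?f (r + 2) z) = theta \<tau> z"
    unfolding theta_def
    by (rule infsum_reindex_bij_witness[of _ "\<lambda>r. r - 2" "\<lambda>r. r + 2"]) auto
  finally show ?thesis .
qed

lemma theta_add_of_int: "theta \<tau> (z + of_int n) = 0 \<longleftrightarrow> theta \<tau> z = 0"
proof (induction n rule: int_induct[of _ 0])
  case (step1 i)
  then show ?case using theta_add_1[of \<tau> "z + of_int i"] by (simp add: add_ac)
next
  case (step2 i)
  then show ?case using theta_add_1[of \<tau> "z + of_int (i - 1)"] by (simp add: add_ac)
qed auto

text \<open>The terms of the theta series for $r = 2n+1$ and $r = -(2n+1)$ together.\<close>

definition theta_term :: "nat \<Rightarrow> complex \<Rightarrow> complex \<Rightarrow> complex" where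
  "theta_term n \<tau> z = (-1) ^ n * e_pow (of_nat (2 * n + 1) ^ 2 / 8) \<tau> *
     (e_pow (of_nat (2 * n + 1) / 2) z - e_pow (- of_nat (2 * n + 1) / 2) z)"

text \<open>Bounds each of the two exponentials in \<open>theta_term n\<close>, uniformly for Im
  \<tau> at least \<open>d\<close> and |Im z| at most \<open>R\<close>; hence the factor 2 in
  \<open>norm_theta_term_le\<close>.\<close>

definition theta_majorant :: "real \<Rightarrow> real \<Rightarrow> nat \<Rightarrow> real" where
  "theta_majorant d R n = exp (- (pi * d * real (2 * n + 1) ^ 2 / 4)) * exp (pi * R * real (2 * n + 1))"

lemma summable_theta_majorant:
  assumes "d > 0"
  shows "summable (theta_majorant d R)"
proof (rule summable_comparison_test_bigo)
  show "summable (\<lambda>n. norm (exp (- real n)))"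
    using summable_geometric[of "exp (-1 :: real)"] by (simp add: exp_of_nat_mult[symmetric])
  have "(\<lambda>n. exp (- (e * real (2 * n + 1) ^ 2 / 4)) * exp (S * real (2 * n + 1))) \<in> O(\<lambda>n. exp (- real n))"
    if "e > 0" for e S :: real
  proof (rule bigoI[of _ 1], rule eventually_sequentiallyI)
    fix n :: nat
    \<comment> \<open>From here on the quadratic exponent wins: m \<ge> 4(S + 1)/e gives e m^2/4
      \<ge> (S + 1) m.\<close>
    assume n: "n \<ge> nat \<lceil>4 * (S + 1) / e\<rceil>"
    define m where "m = real (2 * n + 1)"
    have m: "m \<ge> real n" "m \<ge> 0" by (auto simp: m_def)
    have "4 * (S + 1) / e \<le> m" using n m by linarith
    then have "(4 * (S + 1)) * m \<le> (e * m) * m"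
      using that m by (intro mult_right_mono) (auto simp: field_simps)
    then have "- (e * m ^ 2 / 4) + S * m \<le> - real n"
      using m by (simp add: power2_eq_square algebra_simps)
    then show "norm (exp (- (e * real (2 * n + 1) ^ 2 / 4)) * exp (S * real (2 * n + 1))) \<le> 1 * norm (exp (- real n))"
      unfolding m_def[symmetric] by (simp add: exp_add[symmetric])
  qed
  from this[of "pi * d" "pi * R"] show "theta_majorant d R \<in> O(\<lambda>n. exp (- real n))"
    unfolding theta_majorant_def[abs_def] using assms by simp
qed

lemma norm_half_integer_power_le:
  assumes "\<bar>Im z\<bar> \<le> R" "\<sigma> \<in> {1, -1}"
  shows "norm (e_pow (\<sigma> * of_nat m / 2) z) \<le> exp (pi * R * real m)"
proof -
  have "norm (e_pow (\<sigma> * of_nat m / 2) z) = exp (- (pi * Re \<sigma> * real m * Im z))"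
    using assms by (subst norm_e_pow) auto
  also have "\<dots> \<le> exp (pi * R * real m)"
  proof -
    have "- (Re \<sigma> * Im z) \<le> R" using assms by auto
    then have "pi * real m * - (Re \<sigma> * Im z) \<le> pi * real m * R"
      by (intro mult_left_mono) auto
    then show ?thesis by (simp add: mult_ac)
  qed
  finally show ?thesis .
qed

lemma norm_theta_coeff_le:
  assumes "d \<le> Im \<tau>"
  shows "norm (e_pow (of_nat m ^ 2 / 8) \<tau>) \<le> exp (- (pi * d * real m ^ 2 / 4))"
proof -
  have "norm (e_pow (of_nat m ^ 2 / 8) \<tau>) = exp (- (2 * pi * (real m ^ 2 / 8) * Im \<tau>))"
    using norm_e_pow_of_real[of "real m ^ 2 / 8" \<tau>] by simp
  also have "\<dots> \<le> exp (- (pi * d * real m ^ 2 / 4))"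
    using mult_left_mono[OF assms, of "pi * real m ^ 2"] by (simp add: field_simps)
  finally show ?thesis .
qed

lemma norm_theta_term_le:
  assumes "d \<le> Im \<tau>" "\<bar>Im z\<bar> \<le> R"
  shows "norm (theta_term n \<tau> z) \<le> 2 * theta_majorant d R n"
proof -
  have "norm (e_pow (of_nat (2 * n + 1) / 2) z - e_pow (- of_nat (2 * n + 1) / 2) z) \<le>
     exp (pi * R * real (2 * n + 1)) + exp (pi * R * real (2 * n + 1))"
    using norm_half_integer_power_le[OF assms(2), of 1 "2 * n + 1"]
      norm_half_integer_power_le[OF assms(2), of "-1" "2 * n + 1"]
    by (intro order.trans[OF norm_triangle_ineq4] add_mono) (simp_all del: of_nat_Suc of_nat_add)
  then have "norm (theta_term n \<tau> z) \<le> exp (- (pi * d * real (2 * n + 1) ^ 2 / 4)) *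
     (exp (pi * R * real (2 * n + 1)) + exp (pi * R * real (2 * n + 1)))"
    unfolding theta_term_def norm_mult norm_power
    using norm_theta_coeff_le[OF assms(1), of "2 * n + 1"]
    by (intro mult_mono) (auto simp del: of_nat_Suc of_nat_add)
  then show ?thesis by (simp add: theta_majorant_def algebra_simps)
qed

text \<open>\<open>theta\<close> is an unordered sum over all integers. Absolute convergence permits
  splitting the odd indices by sign and adding the two series termwise; at even indices the
  Kronecker symbol is 0.\<close>

lemma theta_conv_suminf:
  assumes "\<tau> \<in> upper_half_plane"
  shows "theta \<tau> z = (\<Sum>n. theta_term n \<tau> z)"
proof -
  define f where "f r = kronecker_m4 r * e_pow (of_int r ^ 2 / 8) \<tau> * e_pow (of_int r / 2) z" for r
  define g where "g \<sigma> n = \<sigma> * (2 * int n + 1)" for \<sigma> n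
  have d: "Im \<tau> > 0" using assms by (simp add: upper_half_plane_def)
  have kron: "kronecker_m4 (g 1 n) = (-1) ^ n" "kronecker_m4 (g (-1) n) = - ((-1) ^ n)" for n
  proof -
    have "(2 * int n + 1) mod 4 = (if even n then 1 else 3)" by presburger
    moreover have "(- (2 * int n + 1)) mod 4 = (if even n then 3 else 1)" by presburger
    ultimately show "kronecker_m4 (g 1 n) = (-1) ^ n" "kronecker_m4 (g (-1) n) = - ((-1) ^ n)"
      by (auto simp: kronecker_m4_def g_def)
  qed
  have sq: "of_int (g \<sigma> n) ^ 2 = (of_nat (2 * n + 1) ^ 2 :: complex)" if "\<sigma> \<in> {1, -1}" for \<sigma> n
    using that by (auto simp: g_def power2_eq_square algebra_simps)
  have "summable (\<lambda>n. norm (f (g \<sigma> n)))" if \<sigma>: "\<sigma> \<in> {1, -1}" for \<sigma>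
  proof (rule summable_comparison_test[OF _ summable_theta_majorant[OF d, of "\<bar>Im z\<bar>"]], intro exI allI impI)
    fix n
    have "of_int (g \<sigma> n) / 2 = (of_int \<sigma> * of_nat (2 * n + 1) / 2 :: complex)"
      by (simp add: g_def)
    then have "norm (e_pow (of_int (g \<sigma> n) / 2) z) \<le> exp (pi * \<bar>Im z\<bar> * real (2 * n + 1))"
      using norm_half_integer_power_le[of z "\<bar>Im z\<bar>" "of_int \<sigma>" "2 * n + 1"] \<sigma> by auto
    moreover have "norm (e_pow (of_int (g \<sigma> n) ^ 2 / 8) \<tau>) \<le> exp (- (pi * Im \<tau> * real (2 * n + 1) ^ 2 / 4))"
      unfolding sq[OF \<sigma>] by (rule norm_theta_coeff_le) simp
    moreover have "norm (kronecker_m4 (g \<sigma> n)) = 1"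
      using kron[of n] \<sigma> by (auto simp: norm_power)
    ultimately show "norm (norm (f (g \<sigma> n))) \<le> theta_majorant (Im \<tau>) \<bar>Im z\<bar> n"
      unfolding f_def norm_mult theta_majorant_def by (simp add: mult_mono)
  qed
  then have summ: "summable (\<lambda>n. norm (f (g 1 n)))" "summable (\<lambda>n. norm (f (g (-1) n)))"
    by auto
  have inj: "inj (g 1)" "inj (g (-1))"
    by (auto simp: inj_def g_def)
  have hs: "(f has_sum (\<Sum>n. f (g 1 n))) (range (g 1))" "(f has_sum (\<Sum>n. f (g (-1) n))) (range (g (-1)))"
    using summ inj by (auto simp: has_sum_reindex o_def
        intro!: norm_summable_imp_has_sum summable_sums intro: summable_norm_cancel)
  have "(f has_sum (\<Sum>n. f (g 1 n)) + (\<Sum>n. f (g (-1) n))) (range (g 1) \<union> range (g (-1)))"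
    by (rule has_sum_Un_disjoint[OF hs]) (auto simp: g_def)
  also have "?this \<longleftrightarrow> (f has_sum (\<Sum>n. f (g 1 n)) + (\<Sum>n. f (g (-1) n))) UNIV"
  proof (rule has_sum_cong_neutral)
    fix r assume r: "r \<in> UNIV - (range (g 1) \<union> range (g (-1)))"
    have "even r"
    proof (rule ccontr)
      assume "odd r"
      then obtain k where k: "r = 2 * k + 1" by (elim oddE)
      have "r = g 1 (nat k) \<or> r = g (-1) (nat (- k - 1))"
        by (cases "k \<ge> 0") (auto simp: g_def k)
      then show False using r by auto
    qed
    then show "f r = 0" by (simp add: f_def kronecker_m4_def)
  qed auto
  finally have "theta \<tau> z = (\<Sum>n. f (g 1 n)) + (\<Sum>n. f (g (-1) n))"
    unfolding theta_def f_def by (rule infsumI)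
  also have "\<dots> = (\<Sum>n. f (g 1 n) + f (g (-1) n))"
    using summ by (intro suminf_add) (auto intro: summable_norm_cancel)
  also have "\<dots> = (\<Sum>n. theta_term n \<tau> z)"
  proof (intro suminf_cong)
    fix n
    have 1: "of_int (g 1 n) = (of_nat (2 * n + 1) :: complex)" "of_int (g (-1) n) = (- of_nat (2 * n + 1) :: complex)"
      by (simp_all add: g_def)
    have "f (g 1 n) + f (g (- 1) n) = (-1) ^ n * e_pow (of_nat (2 * n + 1) ^ 2 / 8) \<tau> * e_pow (of_nat (2 * n + 1) / 2) z
       - (-1) ^ n * e_pow (of_nat (2 * n + 1) ^ 2 / 8) \<tau> * e_pow (- of_nat (2 * n + 1) / 2) z"
      unfolding f_def kron sq[of 1, simplified] sq[of "-1", simplified] unfolding 1 by simp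
    then show "f (g 1 n) + f (g (- 1) n) = theta_term n \<tau> z"
      unfolding theta_term_def by (simp only: right_diff_distrib)
  qed
  finally show ?thesis .
qed

section \<open>Continuity and holomorphy of the theta function\<close>

text \<open>Uniformity in both variables at once serves three purposes: joint continuity, holomorphy
  in z, and holomorphy in \<tau>.\<close>

lemma uniform_limit_theta:
  assumes "d > 0"
  shows "uniform_limit ({\<tau>. d \<le> Im \<tau>} \<times> {z. \<bar>Im z\<bar> \<le> R})
     (\<lambda>n (\<tau>, z). \<Sum>i<n. theta_term i \<tau> z) (\<lambda>(\<tau>, z). theta \<tau> z) sequentially"
proof -
  have "uniform_limit ({\<tau>. d \<le> Im \<tau>} \<times> {z. \<bar>Im z\<bar> \<le> R})
     (\<lambda>n x. \<Sum>i<n. case x of (\<tau>, z) \<Rightarrow> theta_term i \<tau> z)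
     (\<lambda>x. \<Sum>i. case x of (\<tau>, z) \<Rightarrow> theta_term i \<tau> z) sequentially"
    using norm_theta_term_le summable_theta_majorant[OF assms, of R]
    by (intro Weierstrass_m_test[where M = "\<lambda>n. 2 * theta_majorant d R n"] summable_mult) auto
  then show ?thesis
    by (rule uniform_limit_cong'[THEN iffD1, rotated 2])
      (use assms in \<open>auto simp: theta_conv_suminf upper_half_plane_def\<close>)
qed

lemma continuous_on_theta: "continuous_on (upper_half_plane \<times> UNIV) (\<lambda>(\<tau>, z). theta \<tau> z)"
proof -
  have "isCont (\<lambda>(\<tau>, z). theta \<tau> z) (\<tau>, z)" if "\<tau> \<in> upper_half_plane" for \<tau> z
  proof -
    define d where "d = Im \<tau> / 2"
    define R where "R = \<bar>Im z\<bar> + 1"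
    have d: "d > 0" "d < Im \<tau>" using that by (auto simp: d_def upper_half_plane_def)
    have "continuous_on ({\<tau>. d \<le> Im \<tau>} \<times> {z. \<bar>Im z\<bar> \<le> R}) (\<lambda>(\<tau>, z). theta \<tau> z)"
      by (rule uniform_limit_theorem[OF _ uniform_limit_theta[OF d(1)]])
        (auto simp: theta_term_def e_pow_def case_prod_beta intro!: always_eventually continuous_intros)
    then have "continuous_on ({\<tau>. d < Im \<tau>} \<times> {z. \<bar>Im z\<bar> < R}) (\<lambda>(\<tau>, z). theta \<tau> z)"
      by (rule continuous_on_subset) auto
    moreover have "open ({\<tau>. d < Im \<tau>} \<times> {z. \<bar>Im z\<bar> < R})"
      by (intro open_Times open_Collect_less continuous_intros)
    moreover have "(\<tau>, z) \<in> {\<tau>. d < Im \<tau>} \<times> {z. \<bar>Im z\<bar> < R}"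
      using d by (auto simp: R_def)
    ultimately show ?thesis
      by (simp add: continuous_on_eq_continuous_at)
  qed
  then show ?thesis
    by (intro continuous_at_imp_continuous_on) auto
qed

lemma open_upper_half_plane: "open upper_half_plane"
  unfolding upper_half_plane_def by (intro open_Collect_less continuous_intros)

lemma holomorphic_on_theta:
  assumes "\<tau> \<in> upper_half_plane"
  shows "theta \<tau> holomorphic_on UNIV"
proof (rule holomorphic_uniform_sequence[where f = "\<lambda>n z. \<Sum>i<n. theta_term i \<tau> z"])
  show "\<exists>d>0. cball z d \<subseteq> UNIV \<and>
      uniform_limit (cball z d) (\<lambda>n z. \<Sum>i<n. theta_term i \<tau> z) (theta \<tau>) sequentially" for z
  proof -
    have sub: "cball z 1 \<subseteq> {w. \<bar>Im w\<bar> \<le> \<bar>Im z\<bar> + 1}"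
    proof
      fix w assume "w \<in> cball z 1"
      then have "norm (w - z) \<le> 1" by (simp add: dist_norm norm_minus_commute)
      then have "\<bar>Im w - Im z\<bar> \<le> 1" using abs_Im_le_cmod[of "w - z"] by simp
      then show "w \<in> {w. \<bar>Im w\<bar> \<le> \<bar>Im z\<bar> + 1}" by simp
    qed
    have "Im \<tau> > 0" using assms by (simp add: upper_half_plane_def)
    from uniform_limit_compose'[OF uniform_limit_theta[OF this, of "\<bar>Im z\<bar> + 1"], of "\<lambda>w. (\<tau>, w)" "cball z 1"] sub
    have "uniform_limit (cball z 1) (\<lambda>n z. \<Sum>i<n. theta_term i \<tau> z) (theta \<tau>) sequentially"
      by (auto simp: Pi_def subset_iff)
    then show ?thesis by (intro exI[of _ 1]) auto
  qed
qed (auto simp: theta_term_def e_pow_def intro!: holomorphic_intros)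

lemma holomorphic_on_theta_tau: "(\<lambda>\<tau>. theta \<tau> z) holomorphic_on upper_half_plane"
proof (rule holomorphic_uniform_sequence[where f = "\<lambda>n \<tau>. \<Sum>i<n. theta_term i \<tau> z"])
  show "\<exists>d>0. cball \<tau> d \<subseteq> upper_half_plane \<and>
      uniform_limit (cball \<tau> d) (\<lambda>n \<tau>. \<Sum>i<n. theta_term i \<tau> z) (\<lambda>\<tau>. theta \<tau> z) sequentially"
    if "\<tau> \<in> upper_half_plane" for \<tau>
  proof -
    define d where "d = Im \<tau> / 2"
    have d: "d > 0" using that by (auto simp: d_def upper_half_plane_def)
    have sub: "cball \<tau> d \<subseteq> {\<tau>. d \<le> Im \<tau>}"
    proof
      fix w assume "w \<in> cball \<tau> d"
      then have "norm (w - \<tau>) \<le> d" by (simp add: dist_norm norm_minus_commute)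
      then have "\<bar>Im w - Im \<tau>\<bar> \<le> d" using abs_Im_le_cmod[of "w - \<tau>"] by simp
      then have "Im \<tau> - Im w \<le> d" by linarith
      then show "w \<in> {\<tau>. d \<le> Im \<tau>}" by (simp add: d_def)
    qed
    from uniform_limit_compose'[OF uniform_limit_theta[OF d, of "\<bar>Im z\<bar>"], of "\<lambda>w. (w, z)" "cball \<tau> d"] sub
    have "uniform_limit (cball \<tau> d) (\<lambda>n \<tau>. \<Sum>i<n. theta_term i \<tau> z) (\<lambda>\<tau>. theta \<tau> z) sequentially"
      by (auto simp: Pi_def subset_iff)
    moreover have "cball \<tau> d \<subseteq> upper_half_plane"
      using sub d by (auto simp: upper_half_plane_def subset_iff intro: less_le_trans)
    ultimately show ?thesis using d by blast
  qed
qed (auto simp: theta_term_def e_pow_def open_upper_half_plane intro!: holomorphic_intros)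

section \<open>The triple product and the zeros of theta\<close>

definition qpoch :: "complex \<Rightarrow> nat \<Rightarrow> complex" where
  "qpoch q n = (\<Prod>k<n. 1 - q ^ Suc k)"

lemma qpoch_0 [simp]: "qpoch q 0 = 1"
  by (simp add: qpoch_def)

lemma qpoch_Suc: "qpoch q (Suc n) = qpoch q n * (1 - q ^ Suc n)"
  by (simp add: qpoch_def)

lemma one_minus_power_nonzero:
  fixes q :: complex
  assumes "norm q < 1"
  shows "1 - q ^ Suc k \<noteq> 0"
proof
  assume "1 - q ^ Suc k = 0"
  then have "norm q ^ Suc k = 1" by (metis eq_iff_diff_eq_0 norm_one norm_power)
  moreover have "norm q ^ Suc k < 1"
    using assms power_decreasing[of 1 "Suc k" "norm q"] by simp
  ultimately show False by simp
qed

lemma qpoch_nonzero: "norm q < 1 \<Longrightarrow> qpoch q n \<noteq> 0"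
  using one_minus_power_nonzero by (simp add: qpoch_def)

text \<open>The Gaussian binomial coefficient $\binom{2N+1}{N-j}_q$.\<close>

definition qbinom_odd :: "complex \<Rightarrow> nat \<Rightarrow> nat \<Rightarrow> complex" where
  "qbinom_odd q N j =
     (if j \<le> N then qpoch q (2 * N + 1) / (qpoch q (N - j) * qpoch q (N + 1 + j)) else 0)"

text \<open>The two \<open>qpoch\<close> factors of the denominator move in opposite directions. For
  \<open>j = N\<close> the left side is the default 0, and so is the right side because of
  \<open>1 - q ^ 0\<close>.\<close>

lemma qbinom_odd_Suc_right:
  assumes "norm q < 1" "j \<le> N"
  shows "qbinom_odd q N (Suc j) = qbinom_odd q N j * (1 - q ^ (N - j)) / (1 - q ^ (N + 2 + j))"
proof (cases "j = N")
  case True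
  then show ?thesis by (simp add: qbinom_odd_def)
next
  case False
  then obtain t where t: "N = j + Suc t"
    using assms(2) by (metis add_Suc_right le_imp_less_or_eq less_imp_Suc_add)
  have nz: "qpoch q n \<noteq> 0" "1 - q ^ Suc n \<noteq> 0" for n
    using assms(1) qpoch_nonzero one_minus_power_nonzero by blast+
  have "qpoch q (N - j) = qpoch q (N - Suc j) * (1 - q ^ (N - j))"
    using qpoch_Suc[of q t] by (simp add: t)
  moreover have "qpoch q (N + 1 + Suc j) = qpoch q (N + 1 + j) * (1 - q ^ (N + 2 + j))"
    using qpoch_Suc[of q "N + 1 + j"] by simp
  moreover have "1 - q ^ (N - j) \<noteq> 0" using nz(2)[of t] by (simp add: t)
  moreover have "1 - q ^ (N + 2 + j) \<noteq> 0" using nz(2)[of "N + 1 + j"] by simp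
  ultimately show ?thesis
    using nz(1) t by (simp add: qbinom_odd_def del: power_Suc)
qed

lemma qpoch_odd_Suc:
  "qpoch q (2 * Suc N + 1) = qpoch q (2 * N + 1) * (1 - q ^ (2 * N + 2)) * (1 - q ^ (2 * N + 3))"
  using qpoch_Suc[of q "2 * N + 1"] qpoch_Suc[of q "2 * N + 2"] by (simp add: eval_nat_numeral)

text \<open>Coefficient comparison for the step from \<open>N\<close> to \<open>Suc N\<close> in
  \<open>finite_triple_product\<close>. The extra \<open>q ^ (N + 1)\<close> stems from index -1,
  which folds back onto index 0 with opposite sign.\<close>

lemma qbinom_odd_rec_0:
  assumes "norm q < 1"
  shows "qbinom_odd q (Suc N) 0 =
    (1 + q ^ (2 * N + 2) + q ^ (N + 1)) * qbinom_odd q N 0 + q ^ (N + 2) * qbinom_odd q N 1"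
proof -
  have nz: "qpoch q n \<noteq> 0" "1 - q ^ Suc n \<noteq> 0" for n
    using assms(1) qpoch_nonzero one_minus_power_nonzero by blast+
  define X where "X = qbinom_odd q N 0"
  define y where "y = q ^ N"
  have pows: "q ^ (N + 1) = q * y" "q ^ (N + 2) = q * q * y" "q ^ (2 * N + 2) = q * q * y * y"
    "q ^ (2 * N + 3) = q * q * q * y * y"
    by (simp_all add: y_def power_add mult_2 eval_nat_numeral)
  have nz1: "1 - q * y \<noteq> 0" "1 - q * q * y \<noteq> 0"
    using nz(2)[of N] nz(2)[of "N + 1"] by (simp_all add: y_def mult_ac)
  have 1: "qbinom_odd q (Suc N) 0 = X * (1 - q * q * y * y) * (1 - q * q * q * y * y) / ((1 - q * y) * (1 - q * q * y))"
    using nz qpoch_Suc[of q N] qpoch_Suc[of q "N + 1"] qpoch_odd_Suc[of q N]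
    unfolding qbinom_odd_def X_def pows by (simp add: y_def mult_ac)
  have 2: "qbinom_odd q N 1 = X * (1 - y) / (1 - q * q * y)"
    using qbinom_odd_Suc_right[of q 0 N] assms by (simp add: X_def y_def mult_ac)
  show ?thesis
    unfolding 1 2 X_def[symmetric] pows using nz1 by (simp add: divide_simps) (simp add: algebra_simps)
qed

text \<open>The same comparison at a positive index. Once all coefficients are multiples of
  \<open>X\<close>, it is a rational identity in a few powers of \<open>q\<close>.\<close>

lemma qbinom_odd_rec_Suc:
  assumes "norm q < 1" "j \<le> N"
  shows "qbinom_odd q (Suc N) (Suc j) =
    (1 + q ^ (2 * N + 2)) * qbinom_odd q N (Suc j) + q ^ (N - j) * qbinom_odd q N j
     + q ^ (N + 3 + j) * qbinom_odd q N (Suc (Suc j))"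
proof -
  have nz: "qpoch q n \<noteq> 0" "1 - q ^ Suc n \<noteq> 0" for n
    using assms(1) qpoch_nonzero one_minus_power_nonzero by blast+
  define X where "X = qbinom_odd q N j"
  define a where "a = q ^ (N - j)"
  define y where "y = q ^ (N + 2 + j)"
  have pows: "q ^ (N + 3 + j) = q * y" "q ^ (2 * N + 2) = a * y" "q ^ (2 * N + 3) = q * a * y"
  proof -
    have "N - j + (N + 2 + j) = 2 * N + 2" "Suc (N - j + (N + 2 + j)) = 2 * N + 3" "Suc (N + 2 + j) = N + 3 + j"
      using assms(2) by simp_all
    then show "q ^ (N + 3 + j) = q * y" "q ^ (2 * N + 2) = a * y" "q ^ (2 * N + 3) = q * a * y"
      unfolding a_def y_def by (metis power_add power_Suc mult.assoc)+
  qed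
  have nz1: "1 - y \<noteq> 0" "1 - q * y \<noteq> 0"
    using nz(2)[of "N + 1 + j"] nz(2)[of "N + 2 + j"] by (simp_all add: y_def)
  have 1: "qbinom_odd q (Suc N) (Suc j) = X * (1 - a * y) * (1 - q * a * y) / ((1 - y) * (1 - q * y))"
    using nz qpoch_Suc[of q "N + 1 + j"] qpoch_Suc[of q "N + 2 + j"] qpoch_odd_Suc[of q N] assms(2)
    unfolding qbinom_odd_def X_def pows by (simp add: y_def mult_ac)
  have 2: "qbinom_odd q N (Suc j) = X * (1 - a) / (1 - y)"
    using qbinom_odd_Suc_right[OF assms] by (simp add: X_def y_def a_def)
  show ?thesis
  proof (cases "j = N")
    case True
    then have "a = 1" "qbinom_odd q N (Suc (Suc j)) = 0" by (simp_all add: a_def qbinom_odd_def)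
    then show ?thesis
      unfolding 1 2 X_def[symmetric] a_def[symmetric] pows using nz1 by simp
  next
    case False
    define b where "b = q ^ (N - Suc j)"
    have ab: "a = q * b"
      using False assms(2) unfolding a_def b_def by (metis Suc_diff_Suc le_neq_implies_less power_Suc)
    have 3: "qbinom_odd q N (Suc (Suc j)) = X * (1 - a) * (1 - b) / ((1 - y) * (1 - q * y))"
      using qbinom_odd_Suc_right[of q "Suc j" N] assms False 2 by (simp add: y_def b_def)
    show ?thesis
      unfolding 1 2 3 X_def[symmetric] a_def[symmetric] pows unfolding ab using nz1
      by (simp add: divide_simps) (simp add: algebra_simps)
  qed
qed

text \<open>
  The number $2N+1$ of factors is odd so that the coefficients of $u^{2j+1}$ and $v^{2j+1}$ are equal
  up to sign, which matches the pairing in the theta series.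
\<close>

lemma finite_triple_product:
  fixes q u v :: complex
  assumes "norm q < 1" and uv: "u * v = 1"
  defines "w \<equiv> \<lambda>j. (-1) ^ j * q ^ (\<Sum>i\<le>j. i)" and "s \<equiv> \<lambda>j. u ^ (2 * j + 1) - v ^ (2 * j + 1)"
  shows "(u - v) * (\<Prod>k<N. (1 - q ^ Suc k * u ^ 2) * (1 - q ^ Suc k * v ^ 2)) =
     (\<Sum>j\<le>N. qbinom_odd q N j * w j * s j)"
proof (induction N)
  case 0
  then show ?case
    using qpoch_nonzero[OF assms(1), of 1] by (simp add: qbinom_odd_def w_def s_def)
next
  case (Suc N)
  let ?c = "qbinom_odd q" and ?m = "q ^ Suc N"
  have s0: "s 0 * (u ^ 2 + v ^ 2) = s 1 - s 0"
  proof -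
    have "s 0 * (u ^ 2 + v ^ 2) = u ^ 3 - v ^ 3 + (u * v) * (v - u)"
      unfolding s_def by (simp add: power2_eq_square power3_eq_cube algebra_simps)
    then show ?thesis
      unfolding uv by (simp add: s_def eval_nat_numeral)
  qed
  have sS: "s (Suc j) * (u ^ 2 + v ^ 2) = s (Suc (Suc j)) + s j" for j
  proof -
    have "s (Suc j) * (u ^ 2 + v ^ 2) = u ^ (2 * Suc j + 1) * u ^ 2 - v ^ (2 * Suc j + 1) * v ^ 2
        + (u * v) * (u * v) * (u ^ (2 * j + 1) - v ^ (2 * j + 1))"
      unfolding s_def by (simp add: power2_eq_square algebra_simps)
    then show ?thesis
      unfolding uv by (simp add: s_def power2_eq_square algebra_simps)
  qed
  have wS: "w (Suc j) = - (q ^ Suc j) * w j" for j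
    by (simp add: w_def power_add mult_ac)
  \<comment> \<open>\<open>sm j\<close> stands for \<open>s\<close> at index \<open>j - 1\<close>.
    As \<open>u * v = 1\<close>, the value at index -1 is \<open>- s 0\<close>, and with this
    convention one three-term recurrence covers every \<open>j\<close>.\<close>
  define sm where "sm j = (case j of 0 \<Rightarrow> - s 0 | Suc i \<Rightarrow> s i)" for j
  have step: "s j * (u ^ 2 + v ^ 2) = s (Suc j) + sm j" for j
    using s0 sS by (cases j) (simp_all add: sm_def)
  have fac: "(1 - ?m * u ^ 2) * (1 - ?m * v ^ 2) = 1 + ?m ^ 2 - ?m * (u ^ 2 + v ^ 2)"
  proof -
    have "(1 - ?m * u ^ 2) * (1 - ?m * v ^ 2) = 1 + ?m ^ 2 * (u * v) ^ 2 - ?m * (u ^ 2 + v ^ 2)"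
      by (simp add: power2_eq_square algebra_simps)
    then show ?thesis unfolding uv by simp
  qed
  have "(u - v) * (\<Prod>k<Suc N. (1 - q ^ Suc k * u ^ 2) * (1 - q ^ Suc k * v ^ 2)) =
     (\<Sum>j\<le>N. ?c N j * w j * s j) * (1 + ?m ^ 2 - ?m * (u ^ 2 + v ^ 2))"
    unfolding Suc.IH[symmetric] fac[symmetric] by simp
  also have "\<dots> = (\<Sum>j\<le>N. (1 + ?m ^ 2) * ?c N j * w j * s j - ?m * ?c N j * w j * (s j * (u ^ 2 + v ^ 2)))"
    unfolding sum_distrib_right by (intro sum.cong) (simp_all add: algebra_simps)
  also have "\<dots> = (\<Sum>j\<le>N. (1 + ?m ^ 2) * ?c N j * w j * s j) - (\<Sum>j\<le>N. ?m * ?c N j * w j * sm j)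
       - (\<Sum>j\<le>N. ?m * ?c N j * w j * s (Suc j))"
    unfolding step sum_subtractf[symmetric] by (intro sum.cong) (simp_all add: algebra_simps)
  \<comment> \<open>\<open>qbinom_odd q N\<close> vanishes beyond \<open>N\<close>, so the ranges
    can be lengthened until the shifted sums line up.\<close>
  also have "(\<Sum>j\<le>N. (1 + ?m ^ 2) * ?c N j * w j * s j) = (\<Sum>j\<le>Suc N. (1 + ?m ^ 2) * ?c N j * w j * s j)"
    by (simp add: qbinom_odd_def)
  also have "\<dots> = (1 + ?m ^ 2) * ?c N 0 * w 0 * s 0 + (\<Sum>j\<le>N. (1 + ?m ^ 2) * ?c N (Suc j) * w (Suc j) * s (Suc j))"
    by (rule sum.atMost_Suc_shift)
  also have "(\<Sum>j\<le>N. ?m * ?c N j * w j * sm j) = (\<Sum>j\<le>Suc (Suc N). ?m * ?c N j * w j * sm j)"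
    by (simp add: qbinom_odd_def)
  also have "\<dots> = - ?m * ?c N 0 * w 0 * s 0 + (\<Sum>j\<le>Suc N. ?m * ?c N (Suc j) * w (Suc j) * s j)"
    by (subst sum.atMost_Suc_shift) (simp add: sm_def)
  also have "(\<Sum>j\<le>Suc N. ?m * ?c N (Suc j) * w (Suc j) * s j) =
       ?m * ?c N 1 * w 1 * s 0 + (\<Sum>j\<le>N. ?m * ?c N (Suc (Suc j)) * w (Suc (Suc j)) * s (Suc j))"
    by (subst sum.atMost_Suc_shift) simp
  also have "(1 + ?m ^ 2) * ?c N 0 * w 0 * s 0 + (\<Sum>j\<le>N. (1 + ?m ^ 2) * ?c N (Suc j) * w (Suc j) * s (Suc j))
      - (- ?m * ?c N 0 * w 0 * s 0 + (?m * ?c N 1 * w 1 * s 0 + (\<Sum>j\<le>N. ?m * ?c N (Suc (Suc j)) * w (Suc (Suc j)) * s (Suc j))))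
      - (\<Sum>j\<le>N. ?m * ?c N j * w j * s (Suc j)) =
      ((1 + ?m ^ 2 + ?m) * ?c N 0 * w 0 - ?m * ?c N 1 * w 1) * s 0 +
      (\<Sum>j\<le>N. ((1 + ?m ^ 2) * ?c N (Suc j) * w (Suc j) - ?m * ?c N (Suc (Suc j)) * w (Suc (Suc j)) - ?m * ?c N j * w j) * s (Suc j))"
    by (simp add: left_diff_distrib sum_subtractf sum.distrib algebra_simps)
  also have "(1 + ?m ^ 2 + ?m) * ?c N 0 * w 0 - ?m * ?c N 1 * w 1 = ?c (Suc N) 0 * w 0"
  proof -
    have "w 0 = 1" "w 1 = - q" by (simp_all add: w_def)
    moreover have "?m ^ 2 = q ^ (2 * N + 2)"
      by (simp only: power_mult[symmetric]) (simp add: mult.commute)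
    ultimately show ?thesis
      unfolding qbinom_odd_rec_0[OF assms(1)] by (simp add: algebra_simps)
  qed
  also have "(\<Sum>j\<le>N. ((1 + ?m ^ 2) * ?c N (Suc j) * w (Suc j) - ?m * ?c N (Suc (Suc j)) * w (Suc (Suc j)) - ?m * ?c N j * w j) * s (Suc j))
     = (\<Sum>j\<le>N. ?c (Suc N) (Suc j) * w (Suc j) * s (Suc j))"
  proof (intro sum.cong refl)
    fix j assume "j \<in> {..N}"
    then have j: "j \<le> N" by simp
    have m1: "?m ^ 2 = q ^ (2 * N + 2)"
      by (simp only: power_mult[symmetric]) (simp add: mult.commute)
    have m2: "?m * w j = - (q ^ (N - j) * w (Suc j))"
      using j unfolding wS by (simp add: power_add[symmetric] flip: power_Suc)
    have m3: "?m * w (Suc (Suc j)) = - (q ^ (N + 3 + j) * w (Suc j))"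
      unfolding wS[of "Suc j"] by (simp add: power_add eval_nat_numeral)
    have "(1 + ?m ^ 2) * ?c N (Suc j) * w (Suc j) - ?m * ?c N (Suc (Suc j)) * w (Suc (Suc j)) - ?m * ?c N j * w j =
       (1 + ?m ^ 2) * ?c N (Suc j) * w (Suc j) - ?c N (Suc (Suc j)) * (?m * w (Suc (Suc j))) - ?c N j * (?m * w j)"
      by (simp only: mult_ac)
    also have "\<dots> = ?c (Suc N) (Suc j) * w (Suc j)"
      unfolding m1 m2 m3 qbinom_odd_rec_Suc[OF assms(1) j] by (simp add: algebra_simps)
    finally show "((1 + ?m ^ 2) * ?c N (Suc j) * w (Suc j) - ?m * ?c N (Suc (Suc j)) * w (Suc (Suc j)) - ?m * ?c N j * w j) * s (Suc j)
      = ?c (Suc N) (Suc j) * w (Suc j) * s (Suc j)" by simp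
  qed
  also have "?c (Suc N) 0 * w 0 * s 0 + (\<Sum>j\<le>N. ?c (Suc N) (Suc j) * w (Suc j) * s (Suc j)) =
     (\<Sum>j\<le>Suc N. ?c (Suc N) j * w j * s j)"
    by (rule sum.atMost_Suc_shift[symmetric])
  finally show ?case .
qed

text \<open>A convergent infinite product is zero only if one of its factors is, which
  \<open>norm q < 1\<close> excludes. The nonzero limit later serves as a divisor.\<close>

lemma qpoch_tendsto:
  assumes "norm q < 1"
  obtains L where "qpoch q \<longlonglongrightarrow> L" "L \<noteq> 0"
proof -
  have "summable (\<lambda>k. norm q ^ Suc k)"
    unfolding summable_Suc_iff using assms by (intro summable_geometric) auto
  then have "convergent_prod (\<lambda>k. 1 - q ^ Suc k)"
    by (intro abs_convergent_prod_imp_convergent_prod)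
      (simp add: abs_convergent_prod_conv_summable norm_mult norm_power)
  then have conv: "(\<lambda>n. \<Prod>k\<le>n. 1 - q ^ Suc k) \<longlonglongrightarrow> (\<Prod>k. 1 - q ^ Suc k)"
     and "(\<lambda>n. \<Prod>k\<le>n. 1 - q ^ Suc k) \<longlonglongrightarrow> 0 \<longleftrightarrow> (\<exists>k. 1 - q ^ Suc k = 0)"
    by (rule convergent_prod_LIMSEQ, rule convergent_prod_to_zero_iff)
  then have nz: "(\<Prod>k. 1 - q ^ Suc k) \<noteq> 0"
    using one_minus_power_nonzero[OF assms] by auto
  from conv have "(\<lambda>n. qpoch q (Suc n)) \<longlonglongrightarrow> (\<Prod>k. 1 - q ^ Suc k)"
    by (simp add: qpoch_def lessThan_Suc_atMost)
  then show ?thesis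
    using nz that LIMSEQ_imp_Suc by blast
qed

text \<open>The offset by \<open>j\<close> stays in the nontrivial branch of
  \<open>qbinom_odd\<close>, where the numerator and both factors of the denominator tend to the
  same \<open>L\<close>.\<close>

lemma qbinom_odd_tendsto:
  assumes "qpoch q \<longlonglongrightarrow> L" "L \<noteq> 0"
  shows "(\<lambda>N. qbinom_odd q N j) \<longlonglongrightarrow> inverse L"
proof (rule LIMSEQ_offset[of _ j])
  have "(\<lambda>N. qpoch q (2 * (N + j) + 1) / (qpoch q N * qpoch q (N + j + 1 + j))) \<longlonglongrightarrow> L / (L * L)"
    using assms LIMSEQ_subseq_LIMSEQ[OF assms(1), of "\<lambda>N. 2 * (N + j) + 1"]
      LIMSEQ_subseq_LIMSEQ[OF assms(1), of "\<lambda>N. N + j + 1 + j"]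
    by (intro tendsto_intros) (auto simp: strict_mono_def o_def)
  moreover have "L / (L * L) = inverse L" using assms(2) by (simp add: field_simps)
  ultimately show "(\<lambda>N. qbinom_odd q (N + j) j) \<longlonglongrightarrow> inverse L"
    by (simp add: qbinom_odd_def)
qed

text \<open>Yields the dominating constant for the coefficients \<open>qbinom_odd\<close> and, at a
  positive real argument, the lower bound for the theta product.\<close>

lemma qpoch_bounds:
  assumes "norm q < 1"
  obtains B where "B > 0" "\<And>n. norm (qpoch q n) \<le> B" "\<And>n. norm (inverse (qpoch q n)) \<le> B"
proof -
  obtain L where L: "qpoch q \<longlonglongrightarrow> L" "L \<noteq> 0"
    using qpoch_tendsto[OF assms] .
  have "Bseq (qpoch q)" "Bseq (\<lambda>n. inverse (qpoch q n))"
    using L tendsto_inverse[OF L] by (auto intro!: convergent_imp_Bseq simp: convergent_def)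
  then obtain B1 B2 where "B1 > 0" "\<forall>n. norm (qpoch q n) \<le> B1" "\<forall>n. norm (inverse (qpoch q n)) \<le> B2"
    unfolding Bseq_def by blast
  then show ?thesis
    by (intro that[of "max B1 B2"]) (auto simp: le_max_iff_disj less_max_iff_disj)
qed

lemma norm_nome_less_1:
  assumes "\<tau> \<in> upper_half_plane"
  shows "norm (e_pow 1 \<tau>) < 1"
  using assms norm_e_pow_of_real[of 1 \<tau>] by (simp add: upper_half_plane_def)

text \<open>The exponent (2n + 1)^2/8 is 1/8 plus the triangular number n(n + 1)/2, which brings the
  term into the shape of \<open>finite_triple_product\<close>.\<close>

lemma theta_term_conv_power:
  "theta_term n \<tau> z = e_pow (1/8) \<tau> * (((-1) ^ n * e_pow 1 \<tau> ^ (\<Sum>i\<le>n. i)) *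
     (e_pow (1/2) z ^ (2 * n + 1) - e_pow (-1/2) z ^ (2 * n + 1)))"
proof -
  have "2 * (\<Sum>i\<le>n. i) = n * (n + 1)"
    by (induction n) auto
  from arg_cong[OF this, of "of_nat :: nat \<Rightarrow> complex"]
  have T: "(of_nat n * (of_nat n + 1) :: complex) = 2 * (of_nat (\<Sum>i\<le>n. i))"
    by (simp del: of_nat_sum add: algebra_simps)
  have "of_nat (2 * n + 1) ^ 2 / 8 = 1/8 + (of_nat n * (of_nat n + 1)) / (2 :: complex)"
    by (simp add: power2_eq_square field_simps)
  then have 1: "of_nat (2 * n + 1) ^ 2 / 8 = 1/8 + of_nat (\<Sum>i\<le>n. i) * (1 :: complex)"
    unfolding T by (simp del: of_nat_sum)
  have 2: "of_nat (2 * n + 1) / 2 = of_nat (2 * n + 1) * (1/2 :: complex)"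
    "- of_nat (2 * n + 1) / 2 = of_nat (2 * n + 1) * (-1/2 :: complex)"
    by (simp_all add: field_simps)
  show ?thesis
    unfolding theta_term_def 1 2 e_pow_add e_pow_of_nat_mult by (simp only: mult_ac)
qed

text \<open>Jacobi's triple product as a limit of \<open>finite_triple_product\<close> with u =
  \<zeta>^(1/2) and v = \<zeta>^(-1/2). Tannery's theorem moves the limit into the series: the
  coefficients tend to \<open>inverse L\<close> and are bounded by \<open>B * (B * B)\<close>
  independently of \<open>N\<close> and \<open>j\<close>.\<close>

lemma theta_product_tendsto:
  assumes \<tau>: "\<tau> \<in> upper_half_plane" and L: "qpoch (e_pow 1 \<tau>) \<longlonglongrightarrow> L" "L \<noteq> 0"
  shows "(\<lambda>N. e_pow (1/8) \<tau> * ((e_pow (1/2) z - e_pow (-1/2) z) *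
     (\<Prod>k<N. (1 - e_pow 1 \<tau> ^ Suc k * e_pow (1/2) z ^ 2) * (1 - e_pow 1 \<tau> ^ Suc k * e_pow (-1/2) z ^ 2))))
      \<longlonglongrightarrow> theta \<tau> z / L"
proof -
  let ?q = "e_pow 1 \<tau>"
  have q: "norm ?q < 1" by (rule norm_nome_less_1[OF \<tau>])
  have d: "Im \<tau> > 0" using \<tau> by (simp add: upper_half_plane_def)
  obtain B where B: "B > 0" "\<And>n. norm (qpoch ?q n) \<le> B" "\<And>n. norm (inverse (qpoch ?q n)) \<le> B"
    using qpoch_bounds[OF q] by blast
  have cB: "norm (qbinom_odd ?q N j) \<le> B * (B * B)" for N j
  proof (cases "j \<le> N")
    case True
    then have "norm (qbinom_odd ?q N j) =
       norm (qpoch ?q (2 * N + 1)) * (norm (inverse (qpoch ?q (N - j))) * norm (inverse (qpoch ?q (N + 1 + j))))"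
      by (simp add: qbinom_odd_def norm_divide norm_mult norm_inverse field_simps)
    also have "\<dots> \<le> B * (B * B)"
      using B by (intro mult_mono) auto
    finally show ?thesis .
  qed (use B in \<open>simp add: qbinom_odd_def\<close>)
  \<comment> \<open>The coefficient is 0 for \<open>j > N\<close>, so each finite sum is also a full
    series in \<open>j\<close>, the form required by Tannery's theorem.\<close>
  define a where "a j N = qbinom_odd ?q N j * theta_term j \<tau> z" for j N
  have "(\<lambda>N. suminf (\<lambda>j. a j N)) \<longlonglongrightarrow> (\<Sum>j. inverse L * theta_term j \<tau> z)"
  proof (rule tannerys_theorem[THEN conjunct2, THEN conjunct2])
    show "(\<lambda>N. a j N) \<longlonglongrightarrow> inverse L * theta_term j \<tau> z" for j
      unfolding a_def by (intro tendsto_intros qbinom_odd_tendsto L)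
    show "\<forall>\<^sub>F (j, N) in sequentially \<times>\<^sub>F sequentially.
        norm (a j N) \<le> B * (B * B) * (2 * theta_majorant (Im \<tau>) \<bar>Im z\<bar> j)"
      unfolding a_def norm_mult using cB B norm_theta_term_le[of "Im \<tau>" \<tau> z "\<bar>Im z\<bar>"]
      by (intro always_eventually) (auto intro!: mult_mono)
    show "summable (\<lambda>j. B * (B * B) * (2 * theta_majorant (Im \<tau>) \<bar>Im z\<bar> j))"
      by (intro summable_mult summable_theta_majorant d)
  qed auto
  also have "(\<Sum>j. inverse L * theta_term j \<tau> z) = theta \<tau> z / L"
  proof -
    have "summable (\<lambda>j. theta_term j \<tau> z)"
      using norm_theta_term_le[of "Im \<tau>" \<tau> z "\<bar>Im z\<bar>"]
      by (intro summable_comparison_test[OF _ summable_mult[OF summable_theta_majorant[OF d, of "\<bar>Im z\<bar>"], of 2]]) auto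
    then show ?thesis
      by (simp add: suminf_mult theta_conv_suminf[OF \<tau>] divide_inverse mult.commute)
  qed
  also have "(\<lambda>N. suminf (\<lambda>j. a j N)) = (\<lambda>N. e_pow (1/8) \<tau> * ((e_pow (1/2) z - e_pow (-1/2) z) *
     (\<Prod>k<N. (1 - ?q ^ Suc k * e_pow (1/2) z ^ 2) * (1 - ?q ^ Suc k * e_pow (-1/2) z ^ 2))))"
  proof
    fix N
    have uv: "e_pow (1/2) z * e_pow (-1/2) z = 1"
      using e_pow_add[of "1/2" "-1/2" z] by simp
    have "suminf (\<lambda>j. a j N) = (\<Sum>j\<le>N. a j N)"
      by (intro suminf_finite) (auto simp: a_def qbinom_odd_def)
    also have "\<dots> = e_pow (1/8) \<tau> * (\<Sum>j\<le>N. qbinom_odd ?q N j * ((-1) ^ j * ?q ^ (\<Sum>i\<le>j. i)) *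
       (e_pow (1/2) z ^ (2 * j + 1) - e_pow (-1/2) z ^ (2 * j + 1)))"
      unfolding a_def theta_term_conv_power sum_distrib_left by (intro sum.cong) (simp_all only: mult_ac)
    finally show "suminf (\<lambda>j. a j N) = e_pow (1/8) \<tau> * ((e_pow (1/2) z - e_pow (-1/2) z) *
     (\<Prod>k<N. (1 - ?q ^ Suc k * e_pow (1/2) z ^ 2) * (1 - ?q ^ Suc k * e_pow (-1/2) z ^ 2)))"
      unfolding finite_triple_product[OF q uv] .
  qed
  finally show ?thesis .
qed

text \<open>
  In this strip every factor of the product other than $\zeta^{1/2} - \zeta^{-1/2}$ is bounded below by
  $1 - \rho^k$ with $\rho = |q|^{1/2}$. The bound yields both the zeros in the strip, which contains a
  fundamental domain, and the simplicity of the zero at $0$.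
\<close>

lemma theta_lower_bound:
  assumes \<tau>: "\<tau> \<in> upper_half_plane"
  obtains C where "C > 0"
    "\<And>z. \<bar>Im z\<bar> \<le> Im \<tau> / 2 \<Longrightarrow> norm (theta \<tau> z) \<ge> C * norm (e_pow (1/2) z - e_pow (-1/2) z)"
proof -
  let ?q = "e_pow 1 \<tau>"
  define \<rho> where "\<rho> = exp (- (pi * Im \<tau>))"
  have \<rho>: "0 < \<rho>" "\<rho> < 1" using \<tau> by (auto simp: \<rho>_def upper_half_plane_def)
  obtain L where L: "qpoch ?q \<longlonglongrightarrow> L" "L \<noteq> 0"
    using qpoch_tendsto[OF norm_nome_less_1[OF \<tau>]] .
  \<comment> \<open>The bounds on \<open>qpoch\<close> at the real argument \<rho> turn estimates of
    single factors into one bound for all partial products.\<close>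
  have "norm (of_real \<rho> :: complex) < 1" using \<rho> by simp
  then obtain B where B: "B > 0" "\<And>n. norm (inverse (qpoch (of_real \<rho>) n)) \<le> B"
    using qpoch_bounds by blast
  have rB: "(\<Prod>k<N. 1 - \<rho> ^ Suc k) \<ge> inverse B" for N
  proof -
    have "norm (qpoch (of_real \<rho>) N) = (\<Prod>k<N. norm (of_real (1 - \<rho> ^ Suc k) :: complex))"
      by (simp add: qpoch_def prod_norm)
    also have "\<dots> = (\<Prod>k<N. 1 - \<rho> ^ Suc k)"
    proof (intro prod.cong refl)
      fix k
      have "\<rho> ^ Suc k \<le> 1" using \<rho> by (intro power_le_one) auto
      then show "norm (of_real (1 - \<rho> ^ Suc k) :: complex) = 1 - \<rho> ^ Suc k"
        unfolding norm_of_real by simp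
    qed
    finally have eq: "norm (qpoch (of_real \<rho>) N) = (\<Prod>k<N. 1 - \<rho> ^ Suc k)" .
    have "qpoch (of_real \<rho>) N \<noteq> 0" using \<rho> by (intro qpoch_nonzero) auto
    then have "norm (qpoch (of_real \<rho>) N) \<ge> inverse B"
      using le_imp_inverse_le[OF B(2)[of N]] by (simp add: norm_inverse)
    then show ?thesis unfolding eq .
  qed
  \<comment> \<open>One \<open>inverse B\<close> for each of the two products over \<open>k\<close>;
    \<open>norm L\<close> undoes the division by \<open>L\<close> in the limit.\<close>
  define C where "C = norm L * (norm (e_pow (1/8) \<tau>) * (inverse B * inverse B))"
  have "C > 0" using L B by (simp add: C_def)
  moreover have "norm (theta \<tau> z) \<ge> C * norm (e_pow (1/2) z - e_pow (-1/2) z)"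
    if z: "\<bar>Im z\<bar> \<le> Im \<tau> / 2" for z
  proof -
    let ?u = "e_pow (1/2) z" and ?v = "e_pow (-1/2) z"
    have sq: "?u ^ 2 = e_pow 1 z" "?v ^ 2 = e_pow (-1) z"
      using e_pow_of_nat_mult[of 2 "1/2" z] e_pow_of_nat_mult[of 2 "-1/2" z] by simp_all
    \<comment> \<open>Since |q| = \<rho>^2 and |w| is at most 1/\<rho>, the subtracted term is at
      most \<rho>^(2k+1), hence at most \<rho>^(k+1).\<close>
    have fac: "norm (1 - ?q ^ Suc k * w) \<ge> 1 - \<rho> ^ Suc k" if "norm w \<le> exp (pi * Im \<tau>)" for w k
    proof -
      have "norm ?q = \<rho> ^ 2"
        using norm_e_pow_of_real[of 1 \<tau>] by (simp add: \<rho>_def exp_of_nat_mult[symmetric] mult_ac)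
      then have "norm (?q ^ Suc k * w) \<le> (\<rho> ^ 2) ^ Suc k * exp (pi * Im \<tau>)"
        using that \<rho> unfolding norm_mult norm_power by (intro mult_mono) auto
      also have "\<dots> = \<rho> ^ Suc k * \<rho> ^ k"
        using \<rho> by (simp add: \<rho>_def exp_minus power_mult[symmetric] field_simps power_add[symmetric] power2_eq_square)
      also have "\<dots> \<le> \<rho> ^ Suc k * 1"
        using \<rho> by (intro mult_left_mono power_le_one) auto
      finally show ?thesis
        using norm_triangle_ineq2[of 1 "?q ^ Suc k * w"] by simp
    qed
    have w: "norm (?u ^ 2) \<le> exp (pi * Im \<tau>)" "norm (?v ^ 2) \<le> exp (pi * Im \<tau>)"
    proof -
      have "pi * \<bar>2 * Im z\<bar> \<le> pi * Im \<tau>" using z by (intro mult_left_mono) auto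
      moreover have "\<bar>2 * pi * Im z\<bar> = pi * \<bar>2 * Im z\<bar>" by (simp add: abs_mult)
      ultimately have "\<bar>2 * pi * Im z\<bar> \<le> pi * Im \<tau>" by simp
      then show "norm (?u ^ 2) \<le> exp (pi * Im \<tau>)" "norm (?v ^ 2) \<le> exp (pi * Im \<tau>)"
        unfolding sq by (simp_all add: norm_e_pow abs_le_iff)
    qed
    have prod_ge: "norm (\<Prod>k<N. (1 - ?q ^ Suc k * ?u ^ 2) * (1 - ?q ^ Suc k * ?v ^ 2)) \<ge> inverse B * inverse B" for N
    proof -
      have "inverse B * inverse B \<le> (\<Prod>k<N. 1 - \<rho> ^ Suc k) * (\<Prod>k<N. 1 - \<rho> ^ Suc k)"
      proof -
        have "0 \<le> inverse B" using B(1) by simp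
        from this order_trans[OF this rB[of N]] show ?thesis
          by (intro mult_mono rB)
      qed
      also have "\<dots> = (\<Prod>k<N. (1 - \<rho> ^ Suc k) * (1 - \<rho> ^ Suc k))"
        by (rule prod.distrib[symmetric])
      also have "\<dots> \<le> (\<Prod>k<N. norm (1 - ?q ^ Suc k * ?u ^ 2) * norm (1 - ?q ^ Suc k * ?v ^ 2))"
      proof (intro prod_mono conjI)
        fix k
        have "\<rho> ^ Suc k \<le> 1" using \<rho> by (intro power_le_one) auto
        then show "0 \<le> (1 - \<rho> ^ Suc k) * (1 - \<rho> ^ Suc k)" by simp
        show "(1 - \<rho> ^ Suc k) * (1 - \<rho> ^ Suc k) \<le> norm (1 - ?q ^ Suc k * ?u ^ 2) * norm (1 - ?q ^ Suc k * ?v ^ 2)"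
          using fac[OF w(1)] fac[OF w(2)] \<open>\<rho> ^ Suc k \<le> 1\<close> by (intro mult_mono) auto
      qed
      also have "\<dots> = norm (\<Prod>k<N. (1 - ?q ^ Suc k * ?u ^ 2) * (1 - ?q ^ Suc k * ?v ^ 2))"
        unfolding norm_mult[symmetric] by (rule prod_norm)
      finally show ?thesis .
    qed
    have "norm (e_pow (1/8) \<tau>) * (norm (?u - ?v) * (inverse B * inverse B)) \<le> norm (theta \<tau> z / L)"
    proof (rule tendsto_lowerbound[OF tendsto_norm[OF theta_product_tendsto[OF \<tau> L, of z]]],
        intro always_eventually allI)
      fix N
      have "norm (?u - ?v) * (inverse B * inverse B) \<le>
          norm ((?u - ?v) * (\<Prod>k<N. (1 - ?q ^ Suc k * ?u ^ 2) * (1 - ?q ^ Suc k * ?v ^ 2)))"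
        unfolding norm_mult[of "?u - ?v"] by (intro mult_left_mono prod_ge norm_ge_zero)
      then show "norm (e_pow (1/8) \<tau>) * (norm (?u - ?v) * (inverse B * inverse B)) \<le>
         norm (e_pow (1/8) \<tau> * ((?u - ?v) * (\<Prod>k<N. (1 - ?q ^ Suc k * ?u ^ 2) * (1 - ?q ^ Suc k * ?v ^ 2))))"
        unfolding norm_mult[of "e_pow (1/8) \<tau>"] by (intro mult_left_mono norm_ge_zero)
    qed auto
    then show ?thesis
      using L by (simp add: C_def norm_divide field_simps)
  qed
  ultimately show ?thesis using that by blast
qed

section \<open>Zeros of theta and their orders\<close>

definition period_lattice :: "complex \<Rightarrow> complex set" where
  "period_lattice \<tau> = {of_int m + of_int n * \<tau> | m n. True}"

lemma theta_add_tau_eq_0_iff: "theta \<tau> (z + \<tau>) = 0 \<longleftrightarrow> theta \<tau> z = 0"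
  by (simp add: theta_add_tau)

lemma theta_add_lattice_eq_0_iff:
  assumes "w \<in> period_lattice \<tau>"
  shows "theta \<tau> (z + w) = 0 \<longleftrightarrow> theta \<tau> z = 0"
proof -
  obtain m n where w: "w = of_int m + of_int n * \<tau>"
    using assms by (auto simp: period_lattice_def)
  have "theta \<tau> (z' + of_int n * \<tau>) = 0 \<longleftrightarrow> theta \<tau> z' = 0" for z'
  proof (induction n rule: int_induct[of _ 0])
    case (step1 i)
    then show ?case using theta_add_tau_eq_0_iff[of \<tau> "z' + of_int i * \<tau>"] by (simp add: algebra_simps)
  next
    case (step2 i)
    then show ?case using theta_add_tau_eq_0_iff[of \<tau> "z' + of_int (i - 1) * \<tau>"] by (simp add: algebra_simps)
  qed auto
  from this[of "z + of_int m"] show ?thesis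
    by (simp add: w theta_add_of_int add.assoc)
qed

lemma theta_0 [simp]: "\<tau> \<in> upper_half_plane \<Longrightarrow> theta \<tau> 0 = 0"
  by (simp add: theta_conv_suminf theta_term_def e_pow_def)

text \<open>Rounding the \<tau>-coordinate translates \<open>z\<close> into the strip of
  \<open>theta_lower_bound\<close>. A zero there forces exp(2 pi i z') = 1, so z' is an
  integer.\<close>

lemma theta_eq_0_iff:
  assumes \<tau>: "\<tau> \<in> upper_half_plane"
  shows "theta \<tau> z = 0 \<longleftrightarrow> z \<in> period_lattice \<tau>"
proof
  assume "z \<in> period_lattice \<tau>"
  then show "theta \<tau> z = 0"
    using theta_add_lattice_eq_0_iff[of z \<tau> 0] \<tau> by simp
next
  assume 0: "theta \<tau> z = 0"
  have d: "Im \<tau> > 0" using \<tau> by (simp add: upper_half_plane_def)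
  define n where "n = round (Im z / Im \<tau>)"
  define z' where "z' = z - of_int n * \<tau>"
  have "- of_int n * \<tau> \<in> period_lattice \<tau>"
    unfolding period_lattice_def mem_Collect_eq
    by (rule exI[of _ 0], rule exI[of _ "- n"]) simp
  from theta_add_lattice_eq_0_iff[OF this, of z] have 0: "theta \<tau> z' = 0"
    using 0 by (simp add: z'_def)
  have "\<bar>Im z / Im \<tau> - of_int n\<bar> \<le> 1 / 2"
    unfolding n_def using of_int_round_abs_le[of "Im z / Im \<tau>"] by (simp add: abs_minus_commute)
  then have "\<bar>Im z / Im \<tau> - of_int n\<bar> * \<bar>Im \<tau>\<bar> \<le> 1 / 2 * Im \<tau>"
    using d by (intro mult_mono) auto
  then have "\<bar>Im z'\<bar> \<le> Im \<tau> / 2"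
  proof -
    assume le: "\<bar>Im z / Im \<tau> - of_int n\<bar> * \<bar>Im \<tau>\<bar> \<le> 1 / 2 * Im \<tau>"
    have "Im z' = (Im z / Im \<tau> - of_int n) * Im \<tau>"
      using d by (simp add: z'_def field_simps)
    then show ?thesis using le by (simp add: abs_mult)
  qed
  note strip = this
  obtain C where C: "C > 0"
      "\<And>z. \<bar>Im z\<bar> \<le> Im \<tau> / 2 \<Longrightarrow> norm (theta \<tau> z) \<ge> C * norm (e_pow (1/2) z - e_pow (-1/2) z)"
    using theta_lower_bound[OF \<tau>] by blast
  have "C * norm (e_pow (1/2) z' - e_pow (-1/2) z') \<le> 0"
    using C(2)[OF strip] 0 by simp
  then have eq: "e_pow (1/2) z' = e_pow (-1/2) z'"
    using C(1) by (simp add: mult_le_0_iff)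
  have "e_pow 1 z' = e_pow (1/2) z' * e_pow (1/2) z'"
    using e_pow_add[of "1/2" "1/2" z'] by simp
  also have "\<dots> = e_pow (1/2) z' * e_pow (-1/2) z'"
    by (simp only: eq)
  also have "\<dots> = 1"
    using e_pow_add[of "1/2" "-1/2" z'] by simp
  finally have "exp (2 * of_real pi * \<i> * z') = 1"
    by (simp add: e_pow_def)
  then obtain k where k: "Re (2 * of_real pi * \<i> * z') = 0" "Im (2 * of_real pi * \<i> * z') = of_int (2 * k) * pi"
    unfolding exp_eq_1 by blast
  then have "z' = of_int k" by (simp add: complex_eq_iff)
  then have "z = of_int k + of_int n * \<tau>" by (simp add: z'_def algebra_simps)
  then show "z \<in> period_lattice \<tau>" by (auto simp: period_lattice_def)
qed

lemma zorder_shift_point: "zorder f (z + w) = zorder (\<lambda>u. f (u + w)) z"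
  by (subst (1 2) zorder_shift) (simp add: add_ac)

text \<open>At z = 1/2 the difference of exponentials in the lower bound is 2i. A single nonzero
  value lets the identity theorem isolate the zeros.\<close>

lemma exists_theta_nonzero:
  assumes "\<tau> \<in> upper_half_plane"
  shows "\<exists>z. theta \<tau> z \<noteq> 0"
proof -
  obtain C where C: "C > 0"
      "\<And>z. \<bar>Im z\<bar> \<le> Im \<tau> / 2 \<Longrightarrow> norm (theta \<tau> z) \<ge> C * norm (e_pow (1/2) z - e_pow (-1/2) z)"
    using theta_lower_bound[OF assms] by blast
  have "e_pow (1/2) (1/2) = \<i>" "e_pow (-1/2) (1/2) = - \<i>"
    by (simp_all add: e_pow_def exp_eq_polar cis_conv_exp[symmetric] complex_eq_iff exp_minus)
  then have "norm (theta \<tau> (1/2)) \<ge> C * norm (2 * \<i>)"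
    using C(2)[of "1/2"] assms by (simp add: upper_half_plane_def)
  then show ?thesis using C(1) by (intro exI[of _ "1/2"]) auto
qed

lemma analytic_on_theta: "\<tau> \<in> upper_half_plane \<Longrightarrow> theta \<tau> analytic_on A"
  using holomorphic_on_theta analytic_on_open analytic_on_subset by (metis open_UNIV subset_UNIV)

lemma eventually_theta_nonzero:
  assumes "\<tau> \<in> upper_half_plane"
  shows "eventually (\<lambda>w. theta \<tau> w \<noteq> 0) (at z)"
proof -
  obtain z0 where "theta \<tau> z0 \<noteq> 0"
    using exists_theta_nonzero[OF assms] by blast
  then have "eventually (\<lambda>w. theta \<tau> w \<noteq> 0 \<and> w \<in> UNIV) (at z)"
    using holomorphic_on_theta[OF assms] by (intro non_zero_neighbour_alt[of _ _ _ z0]) auto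
  then show ?thesis by simp
qed

text \<open>Dividing the lower bound by z and letting z tend to 0 shows that the derivative at 0 has
  modulus at least 2 pi C.\<close>

lemma zorder_theta_0:
  assumes \<tau>: "\<tau> \<in> upper_half_plane"
  shows "zorder (theta \<tau>) 0 = 1"
proof (rule zorder_zero_eqI')
  have hol: "theta \<tau> field_differentiable at 0"
    using holomorphic_on_theta[OF \<tau>] by (simp add: holomorphic_on_def)
  obtain C where C: "C > 0"
      "\<And>z. \<bar>Im z\<bar> \<le> Im \<tau> / 2 \<Longrightarrow> norm (theta \<tau> z) \<ge> C * norm (e_pow (1/2) z - e_pow (-1/2) z)"
    using theta_lower_bound[OF \<tau>] by blast
  have d: "Im \<tau> > 0" using \<tau> by (simp add: upper_half_plane_def)
  have lim: "((\<lambda>z. theta \<tau> z / z) \<longlongrightarrow> deriv (theta \<tau>) 0) (at 0)"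
    using field_differentiable_derivI[OF hol] \<tau> by (simp add: has_field_derivative_iff)
  have "((\<lambda>z. e_pow (1/2) z - e_pow (-1/2) z) has_field_derivative 2 * of_real pi * \<i>) (at 0)"
    unfolding e_pow_def by (auto intro!: derivative_eq_intros)
  then have lim2: "((\<lambda>z. (e_pow (1/2) z - e_pow (-1/2) z) / z) \<longlongrightarrow> 2 * of_real pi * \<i>) (at 0)"
    by (simp add: has_field_derivative_iff e_pow_def)
  have "C * norm (2 * of_real pi * \<i>) \<le> norm (deriv (theta \<tau>) 0)"
  proof (rule tendsto_le[OF _ tendsto_norm[OF lim] tendsto_mult[OF tendsto_const tendsto_norm[OF lim2]]])
    have "eventually (\<lambda>z::complex. \<bar>Im z\<bar> < Im \<tau> / 2) (at 0)"
    proof (rule order_tendstoD)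
      show "((\<lambda>z::complex. \<bar>Im z\<bar>) \<longlongrightarrow> \<bar>Im 0\<bar>) (at 0)" by (intro tendsto_intros)
    qed (use d in auto)
    then show "eventually (\<lambda>z. C * norm ((e_pow (1/2) z - e_pow (-1/2) z) / z) \<le> norm (theta \<tau> z / z)) (at 0)"
    proof eventually_elim
      case (elim z)
      then have "C * norm (e_pow (1/2) z - e_pow (-1/2) z) / norm z \<le> norm (theta \<tau> z) / norm z"
        by (intro divide_right_mono C) auto
      then show ?case by (simp add: norm_divide)
    qed
  qed auto
  moreover have "C * norm (2 * of_real pi * \<i>) > 0" using C(1) by simp
  ultimately show "(deriv ^^ nat 1) (theta \<tau>) 0 \<noteq> 0" by auto
qed (use \<tau> in \<open>auto intro: analytic_on_theta\<close>)

lemma zorder_theta_add_1: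
  assumes "\<tau> \<in> upper_half_plane"
  shows "zorder (theta \<tau>) (z + 1) = zorder (theta \<tau>) z"
  unfolding zorder_shift_point theta_add_1 by (rule Complex_Singularities.zorder_uminus)

text \<open>The automorphy factor is analytic without zeros and therefore has order 0.\<close>

lemma zorder_theta_add_tau:
  assumes \<tau>: "\<tau> \<in> upper_half_plane"
  shows "zorder (theta \<tau>) (z + \<tau>) = zorder (theta \<tau>) z"
proof -
  let ?g = "\<lambda>u. - (e_pow (-1/2) \<tau> * e_pow (-1) u)"
  have ana: "?g analytic_on {z}"
    unfolding e_pow_def by (intro analytic_intros)
  have "zorder (theta \<tau>) (z + \<tau>) = zorder (\<lambda>u. ?g u * theta \<tau> u) z"
    unfolding zorder_shift_point theta_add_tau ..
  also have "\<dots> = zorder ?g z + zorder (theta \<tau>) z"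
  proof (rule zorder_times_analytic[OF ana analytic_on_theta[OF \<tau>]])
    show "eventually (\<lambda>u. ?g u * theta \<tau> u \<noteq> 0) (at z)"
      using eventually_theta_nonzero[OF \<tau>] by eventually_elim simp
  qed
  also have "zorder ?g z = 0"
    by (rule zorder_eq_0I[OF ana]) simp
  finally show ?thesis by simp
qed

lemma int_shift_invariant:
  fixes f :: "'a :: ring_1 \<Rightarrow> 'b"
  assumes "\<And>x. f (x + w) = f x"
  shows "f (x + of_int n * w) = f x"
proof (induction n rule: int_induct[of _ 0])
  case (step1 i)
  then show ?case using assms[of "x + of_int i * w"] by (simp add: algebra_simps)
next
  case (step2 i)
  then show ?case using assms[of "x + of_int (i - 1) * w"] by (simp add: algebra_simps)
qed auto

lemma zorder_theta:
  assumes \<tau>: "\<tau> \<in> upper_half_plane"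
  shows "zorder (theta \<tau>) z = of_bool (z \<in> period_lattice \<tau>)"
proof (cases "z \<in> period_lattice \<tau>")
  case True
  then obtain m n where z: "z = (0 + of_int m * 1) + of_int n * \<tau>"
    by (auto simp: period_lattice_def)
  have "zorder (theta \<tau>) z = zorder (theta \<tau>) 0"
    unfolding z using int_shift_invariant[of "zorder (theta \<tau>)"] zorder_theta_add_1[OF \<tau>] zorder_theta_add_tau[OF \<tau>]
    by metis
  then show ?thesis using True zorder_theta_0[OF \<tau>] by simp
next
  case False
  then show ?thesis
    using zorder_eq_0I[OF analytic_on_theta[OF \<tau>]] theta_eq_0_iff[OF \<tau>] by simp
qed

section \<open>Products of theta functions\<close>

definition theta_prod :: "int list \<Rightarrow> complex \<Rightarrow> complex \<Rightarrow> complex" where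
  "theta_prod as \<tau> z = (\<Prod>a\<leftarrow>as. theta_mult a \<tau> z)"

lemma theta_prod_simps [simp]:
  "theta_prod [] \<tau> z = 1" "theta_prod (a # as) \<tau> z = theta \<tau> (of_int a * z) * theta_prod as \<tau> z"
  by (simp_all add: theta_prod_def theta_mult_def)

lemma holomorphic_on_theta_prod:
  assumes "\<tau> \<in> upper_half_plane"
  shows "theta_prod as \<tau> holomorphic_on UNIV"
proof (induction as)
  case (Cons a as)
  have "(theta \<tau> \<circ> (\<lambda>z. of_int a * z)) holomorphic_on UNIV"
    by (intro holomorphic_on_compose_gen[OF _ holomorphic_on_theta[OF assms]] holomorphic_intros) auto
  then have "(\<lambda>z. theta \<tau> (of_int a * z)) holomorphic_on UNIV"
    by (simp add: o_def)
  then have "(\<lambda>z. theta \<tau> (of_int a * z) * theta_prod as \<tau> z) holomorphic_on UNIV"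
    using Cons.IH by (intro holomorphic_on_mult) auto
  moreover have "theta_prod (a # as) \<tau> = (\<lambda>z. theta \<tau> (of_int a * z) * theta_prod as \<tau> z)"
    by (simp add: fun_eq_iff)
  ultimately show ?case by simp
next
  case Nil
  have "theta_prod [] \<tau> = (\<lambda>_. 1)" by (simp add: fun_eq_iff)
  then show ?case by simp
qed

lemma analytic_on_theta_prod:
  "\<tau> \<in> upper_half_plane \<Longrightarrow> theta_prod as \<tau> analytic_on A"
  using holomorphic_on_theta_prod analytic_on_open analytic_on_subset by (metis open_UNIV subset_UNIV)

lemma eventually_theta_scaled_nonzero:
  assumes "\<tau> \<in> upper_half_plane" "a \<noteq> 0"
  shows "eventually (\<lambda>w. theta \<tau> (of_int a * w) \<noteq> 0) (at z)"
proof -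
  have "filterlim (\<lambda>w. of_int a * w) (at (of_int a * z)) (at z)"
    using assms by (intro filterlim_atI tendsto_intros) (auto simp: eventually_at_filter)
  then show ?thesis
    using eventually_compose_filterlim[OF eventually_theta_nonzero[OF assms(1)]] by blast
qed

lemma eventually_theta_prod_nonzero:
  assumes "\<tau> \<in> upper_half_plane" "0 \<notin> set as"
  shows "eventually (\<lambda>w. theta_prod as \<tau> w \<noteq> 0) (at z)"
  using assms(2)
proof (induction as)
  case (Cons a as)
  then have nz: "eventually (\<lambda>w. theta_prod as \<tau> w \<noteq> 0) (at z)" and a: "a \<noteq> 0" by auto
  from nz eventually_theta_scaled_nonzero[OF assms(1) a, of z] show ?case
    by eventually_elim simp
qed simp

text \<open>Orders add, and the dilation by a nonzero \<open>a\<close> carries the order of theta at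
  \<open>of_int a * z\<close> to \<open>z\<close> unchanged.\<close>

lemma zorder_theta_prod:
  assumes \<tau>: "\<tau> \<in> upper_half_plane" and "0 \<notin> set as"
  shows "zorder (theta_prod as \<tau>) z = int (length (filter (\<lambda>a. of_int a * z \<in> period_lattice \<tau>) as))"
  using assms(2)
proof (induction as)
  case Nil
  have "theta_prod [] \<tau> = (\<lambda>_. 1)" by (simp add: fun_eq_iff)
  then show ?case by simp
next
  case (Cons a as)
  then have a: "a \<noteq> 0" "0 \<notin> set as" by auto
  have eq: "theta_prod (a # as) \<tau> = (\<lambda>z. theta \<tau> (of_int a * z) * theta_prod as \<tau> z)"
    by (simp add: fun_eq_iff)
  have ana: "(\<lambda>z. theta \<tau> (of_int a * z)) analytic_on {z}"
  proof -
    have "theta_prod [a] \<tau> = (\<lambda>z. theta \<tau> (of_int a * z))" by (simp add: fun_eq_iff)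
    then show ?thesis using analytic_on_theta_prod[OF \<tau>, of "[a]"] by simp
  qed
  have "zorder (theta_prod (a # as) \<tau>) z = zorder (\<lambda>z. theta \<tau> (of_int a * z)) z + zorder (theta_prod as \<tau>) z"
    unfolding eq
  proof (rule zorder_times_analytic[OF ana analytic_on_theta_prod[OF \<tau>]])
    show "eventually (\<lambda>w. theta \<tau> (of_int a * w) * theta_prod as \<tau> w \<noteq> 0) (at z)"
      using eventually_theta_prod_nonzero[OF \<tau> Cons.prems] by simp
  qed
  also have "zorder (\<lambda>z. theta \<tau> (of_int a * z)) z = zorder (theta \<tau>) (of_int a * z)"
    using a by (intro Meromorphic.zorder_scale analytic_on_imp_meromorphic_on analytic_on_theta[OF \<tau>]) auto
  finally show ?case
    using Cons.IH a zorder_theta[OF \<tau>] by simp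
qed

section \<open>Holomorphy in two variables\<close>

text \<open>Cauchy's formulas as integrals over the unit interval, the form in which continuity and
  differentiability of parameter integrals can be applied.\<close>

lemma circlepath_integrals:
  assumes "f holomorphic_on S" "cball z r \<subseteq> S" "w \<in> ball z r"
  shows "f w = integral (cbox 0 1) (\<lambda>t. f (circlepath z r t) / (circlepath z r t - w) * (of_real r * exp (2 * of_real pi * \<i> * of_real t)))"
    and "deriv f w = integral (cbox 0 1) (\<lambda>t. f (circlepath z r t) / (circlepath z r t - w) ^ 2 * (of_real r * exp (2 * of_real pi * \<i> * of_real t)))"
proof -
  have r: "r > 0" using assms(3) by (metis ball_eq_empty empty_iff not_le)
  have hol1: "f holomorphic_on cball z r"
    using assms(1,2) by (rule holomorphic_on_subset)
  have hol: "f holomorphic_on ball z r" "continuous_on (cball z r) f"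
    using holomorphic_on_subset[OF hol1 ball_subset_cball] holomorphic_on_imp_continuous_on[OF hol1] by auto
  have eq: "integral (cbox 0 1) (\<lambda>t. g (circlepath z r t) * (of_real r * exp (2 * of_real pi * \<i> * of_real t)))
     = contour_integral (circlepath z r) g / (2 * of_real pi * \<i>)" for g
  proof -
    have "contour_integral (circlepath z r) g =
      integral (cbox 0 1) (\<lambda>t. (2 * of_real pi * \<i>) * (g (circlepath z r t) * (of_real r * exp (2 * of_real pi * \<i> * of_real t))))"
      by (simp add: contour_integral_integral vector_derivative_circlepath mult_ac)
    then show ?thesis by (simp add: integral_mult_right)
  qed
  have "contour_integral (circlepath z r) (\<lambda>u. f u / (u - w)) = 2 * of_real pi * \<i> * f w"
    using hol assms(3) by (intro contour_integral_unique Cauchy_integral_circlepath) (auto simp: dist_norm norm_minus_commute)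
  then show "f w = integral (cbox 0 1) (\<lambda>t. f (circlepath z r t) / (circlepath z r t - w) * (of_real r * exp (2 * of_real pi * \<i> * of_real t)))"
    by (subst eq[of "\<lambda>u. f u / (u - w)"]) simp
  have "contour_integral (circlepath z r) (\<lambda>u. f u / (u - w) ^ 2) = 2 * of_real pi * \<i> * deriv f w"
    using Cauchy_contour_integral_circlepath_2[OF hol(2,1) assms(3)] by simp
  then show "deriv f w = integral (cbox 0 1) (\<lambda>t. f (circlepath z r t) / (circlepath z r t - w) ^ 2 * (of_real r * exp (2 * of_real pi * \<i> * of_real t)))"
    by (subst eq[of "\<lambda>u. f u / (u - w) ^ 2"]) simp
qed

lemma continuous_on_circlepath: "continuous_on A (circlepath z r)"
  unfolding circlepath by (intro continuous_intros)

lemma circlepath_neq_ball: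
  assumes "w \<in> ball z r"
  shows "circlepath z r t \<noteq> w"
proof -
  have "r > 0" using assms by (metis ball_eq_empty empty_iff not_le)
  then have "dist z (circlepath z r t) = r"
    by (simp add: circlepath dist_norm norm_mult)
  then show ?thesis using assms by auto
qed

lemma circlepath_in_sphere: "r \<ge> 0 \<Longrightarrow> circlepath z r t \<in> sphere z r"
  by (simp add: circlepath dist_norm norm_mult)

text \<open>Cauchy's formula expresses the derivative by values of \<open>G\<close> on a circle, and
  joint continuity passes under the integral. The parameter lives in a metric space because it is a
  second complex variable in one use and the real integration variable in another.\<close>

lemma continuous_on_deriv_param:
  fixes G :: "complex \<Rightarrow> 'a::metric_space \<Rightarrow> complex"
  assumes "open A" and cont: "continuous_on (A \<times> S) (\<lambda>(x, s). G x s)"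
    and hol: "\<And>s. s \<in> S \<Longrightarrow> (\<lambda>x. G x s) holomorphic_on A"
  shows "continuous_on (A \<times> S) (\<lambda>(x, s). deriv (\<lambda>x. G x s) x)"
  unfolding continuous_on_eq_continuous_within
proof safe
  fix x0 s0 assume x0: "x0 \<in> A" "s0 \<in> S"
  obtain r where r: "r > 0" "cball x0 r \<subseteq> A"
    using \<open>open A\<close> x0 open_contains_cball by blast
  let ?K = "\<lambda>t. of_real r * exp (2 * of_real pi * \<i> * of_real t) :: complex"
  have "continuous_on (ball x0 r \<times> S) (\<lambda>p. integral (cbox 0 1)
      (\<lambda>t. G (circlepath x0 r t) (snd p) / (circlepath x0 r t - fst p) ^ 2 * ?K t))"
  proof (rule integral_continuous_on_param)
    have "continuous_on ((ball x0 r \<times> S) \<times> cbox 0 1) (\<lambda>q. (circlepath x0 r (snd q), snd (fst q)))"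
      by (intro continuous_intros continuous_on_compose2[OF continuous_on_circlepath]) auto
    moreover have "(\<lambda>q. (circlepath x0 r (snd q), snd (fst q))) ` ((ball x0 r \<times> S) \<times> cbox 0 1) \<subseteq> A \<times> S"
      using r circlepath_in_sphere[of r x0] sphere_cball[of x0 r] by fastforce
    ultimately have "continuous_on ((ball x0 r \<times> S) \<times> cbox 0 1) (\<lambda>q. G (circlepath x0 r (snd q)) (snd (fst q)))"
      using continuous_on_compose2[OF cont, of "(ball x0 r \<times> S) \<times> cbox 0 1" "\<lambda>q. (circlepath x0 r (snd q), snd (fst q))"]
      by simp
    moreover have "continuous_on ((ball x0 r \<times> S) \<times> cbox 0 1) (\<lambda>q. circlepath x0 r (snd q))"
      by (intro continuous_intros continuous_on_compose2[OF continuous_on_circlepath]) auto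
    ultimately show "continuous_on ((ball x0 r \<times> S) \<times> cbox 0 1)
       (\<lambda>(p, t). G (circlepath x0 r t) (snd p) / (circlepath x0 r t - fst p) ^ 2 * ?K t)"
      unfolding case_prod_beta using circlepath_neq_ball
      by (intro continuous_intros) auto
  qed
  then have "continuous_on (ball x0 r \<times> S) (\<lambda>(x, s). deriv (\<lambda>x. G x s) x)"
  proof (rule continuous_on_eq)
    fix p assume "p \<in> ball x0 r \<times> S"
    then show "integral (cbox 0 1) (\<lambda>t. G (circlepath x0 r t) (snd p) / (circlepath x0 r t - fst p) ^ 2 * ?K t)
       = (case p of (x, s) \<Rightarrow> deriv (\<lambda>x. G x s) x)"
      using circlepath_integrals(2)[OF hol r(2)] by (auto simp: case_prod_beta)
  qed
  then have "continuous (at (x0, s0) within ball x0 r \<times> S) (\<lambda>(x, s). deriv (\<lambda>x. G x s) x)"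
    using x0 r by (simp add: continuous_on_eq_continuous_within)
  also have "at (x0, s0) within ball x0 r \<times> S = at (x0, s0) within A \<times> S"
    using r ball_subset_cball[of x0 r] by (intro at_within_nhd[of _ "ball x0 r \<times> UNIV"]) (auto intro: open_Times)
  finally show "continuous (at (x0, s0) within A \<times> S) (\<lambda>(x, s). deriv (\<lambda>x. G x s) x)" .
qed

text \<open>Osgood's lemma. \<open>continuous_on_deriv_param\<close> makes the partial derivative in
  the second variable jointly continuous; with the mere existence of the other partial derivative
  this gives the total derivative.\<close>

lemma holomorphic2_on_Osgood:
  assumes "open A" "open B" and cont: "continuous_on (A \<times> B) (\<lambda>(x, y). f x y)"
    and hol1: "\<And>y. y \<in> B \<Longrightarrow> (\<lambda>x. f x y) holomorphic_on A"
    and hol2: "\<And>x. x \<in> A \<Longrightarrow> f x holomorphic_on B"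
  shows "holomorphic2_on (\<lambda>(x, y). f x y) (A \<times> B)"
  unfolding holomorphic2_on_def
proof safe
  fix x0 y0 assume xy: "x0 \<in> A" "y0 \<in> B"
  \<comment> \<open>\<open>has_derivative_partialsI\<close> works over a convex set in the second
    variable, hence the ball.\<close>
  obtain r where r: "r > 0" "ball y0 r \<subseteq> B"
    using \<open>open B\<close> xy open_contains_ball by blast
  have swap: "continuous_on S (\<lambda>p. (snd p, fst p))" for S :: "(complex \<times> complex) set"
    by (intro continuous_intros)
  have "continuous_on (B \<times> A) (\<lambda>(y, x). f x y)"
  proof -
    have "(\<lambda>p. (snd p, fst p)) ` (B \<times> A) \<subseteq> A \<times> B" by auto
    from continuous_on_compose2[OF cont swap this] show ?thesis by (simp add: case_prod_beta)
  qed
  from continuous_on_deriv_param[OF \<open>open B\<close> this hol2]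
  have c: "continuous_on (B \<times> A) (\<lambda>p. deriv (f (snd p)) (fst p))"
    by (simp add: case_prod_beta)
  have c': "continuous_on (A \<times> ball y0 r) (\<lambda>p. deriv (f (fst p)) (snd p))"
  proof -
    have "(\<lambda>p. (snd p, fst p)) ` (A \<times> ball y0 r) \<subseteq> B \<times> A"
      using r by auto
    from continuous_on_compose2[OF c swap this] show ?thesis by simp
  qed
  have "((\<lambda>(x, y). f x y) has_derivative
      (\<lambda>(tx, ty). deriv (\<lambda>x. f x y0) x0 * tx + blinfun_apply (blinfun_mult_right (deriv (f x0) y0)) ty))
     (at (x0, y0) within A \<times> ball y0 r)"
  proof (rule has_derivative_partialsI)
    show "((\<lambda>x. f x y0) has_derivative (*) (deriv (\<lambda>x. f x y0) x0)) (at x0 within A)"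
      using holomorphic_derivI[OF hol1[OF xy(2)] \<open>open A\<close> xy(1)]
      by (simp add: has_field_derivative_def has_derivative_at_withinI)
    show "(f x has_derivative blinfun_apply (blinfun_mult_right (deriv (f x) y))) (at y within ball y0 r)"
      if "x \<in> A" "y \<in> ball y0 r" for x y
      using holomorphic_derivI[OF hol2[OF that(1)] \<open>open B\<close>, of y] that r
      by (auto simp: has_field_derivative_def has_derivative_at_withinI blinfun_mult_right.rep_eq)
    have "continuous_on (A \<times> ball y0 r) (\<lambda>p. blinfun_mult_right (deriv (f (fst p)) (snd p)))"
      by (intro bounded_linear.continuous_on[OF bounded_linear_blinfun_mult_right] c')
    then have "continuous (at (x0, y0) within A \<times> ball y0 r) (\<lambda>p. blinfun_mult_right (deriv (f (fst p)) (snd p)))"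
      using xy r by (simp add: continuous_on_eq_continuous_within)
    then show "continuous (at (x0, y0) within A \<times> ball y0 r) (\<lambda>(x, y). blinfun_mult_right (deriv (f x) y))"
      by (simp add: case_prod_unfold)
  qed (use r in auto)
  also have "at (x0, y0) within A \<times> ball y0 r = at (x0, y0)"
    using xy r \<open>open A\<close> by (intro at_within_open open_Times) auto
  finally show "\<exists>C D. ((\<lambda>(x, y). f x y) has_derivative (\<lambda>(u, v). C * u + D * v)) (at (x0, y0))"
    by (auto simp: blinfun_mult_right.rep_eq)
qed

text \<open>
  Near $(x_0, y_0)$, the quotient $F$ is the Cauchy integral of $N/D$ over a small circle around $y_0$
  on which $D(x, \cdot)$ has no zero for all $x$ close to $x_0$; so zeros of $D$ inside do not matter.
\<close>

lemma holomorphic2_on_quotient: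
  assumes "open A"
    and contN: "continuous_on (A \<times> UNIV) (\<lambda>(x, y). N x y)"
    and contD: "continuous_on (A \<times> UNIV) (\<lambda>(x, y). D x y)"
    and holN: "\<And>y. (\<lambda>x. N x y) holomorphic_on A"
    and holD: "\<And>y. (\<lambda>x. D x y) holomorphic_on A"
    and nz: "\<And>x y. x \<in> A \<Longrightarrow> eventually (\<lambda>w. D x w \<noteq> 0) (at y)"
    and holF: "\<And>x. x \<in> A \<Longrightarrow> F x holomorphic_on UNIV"
    and eq: "\<And>x y. x \<in> A \<Longrightarrow> F x y * D x y = N x y"
  shows "holomorphic2_on (\<lambda>(x, y). F x y) (A \<times> UNIV)"
  unfolding holomorphic2_on_def
proof safe
  fix x0 y0 assume x0: "x0 \<in> A"
  \<comment> \<open>The zeros of \<open>D x0\<close> are isolated, so the circle of radius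
    \<open>r0 / 2\<close> avoids them even if \<open>y0\<close> is itself a zero.\<close>
  obtain r0 where r0: "r0 > 0" "\<And>w. w \<noteq> y0 \<Longrightarrow> dist w y0 < r0 \<Longrightarrow> D x0 w \<noteq> 0"
    using nz[OF x0, of y0] unfolding eventually_at by auto
  define r where "r = r0 / 2"
  have Dx0: "D x0 w \<noteq> 0" if "w \<in> sphere y0 r" for w
    using r0 that by (auto simp: r_def dist_commute intro!: r0(2))
  have r: "r > 0" using r0 by (simp add: r_def)
  \<comment> \<open>Nonvanishing of \<open>D\<close> is an open condition and the circle is compact,
    so the tube lemma gives one disc of parameters \<open>x\<close> that works for the whole
    circle.\<close>
  define W where "W = {p \<in> A \<times> UNIV. (case p of (x, y) \<Rightarrow> D x y) \<noteq> 0}"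
  have "open W"
  proof -
    have "open ((\<lambda>(x, y). D x y) -` (- {0}) \<inter> (A \<times> UNIV))"
      using contD \<open>open A\<close> by (subst (asm) continuous_on_open_vimage) (auto intro: open_Times)
    then show ?thesis by (simp add: W_def vimage_def Int_def conj_commute)
  qed
  moreover have "{x0} \<times> sphere y0 r \<subseteq> W"
    using x0 Dx0 by (auto simp: W_def)
  ultimately obtain X0 where X0: "x0 \<in> X0" "open X0" "X0 \<times> sphere y0 r \<subseteq> W"
    using Elementary_Topology.tube_lemma[of "sphere y0 r" W x0] by auto
  obtain d where d: "d > 0" "ball x0 d \<subseteq> X0"
    using X0 open_contains_ball by blast
  let ?V = "ball x0 d"
  have VD: "x \<in> A" "D x w \<noteq> 0" if "x \<in> ?V" "w \<in> sphere y0 r" for x w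
  proof -
    have "(x, w) \<in> W" using that d(2) X0(3) by blast
    then show "x \<in> A" "D x w \<noteq> 0" by (auto simp: W_def)
  qed
  obtain w0 where w0: "w0 \<in> sphere y0 r"
    using r circlepath_in_sphere[of r y0 0] by auto
  have VA: "?V \<subseteq> A" using VD w0 by blast
  \<comment> \<open>\<open>F\<close> is controlled only for fixed \<open>x\<close>, but on the
    circle it equals \<open>N / D\<close>, which is jointly continuous and holomorphic in
    \<open>x\<close>. The integrand therefore no longer involves \<open>F\<close>.\<close>
  define K where "K x t = N x (circlepath y0 r t) / D x (circlepath y0 r t) *
      (of_real r * exp (2 * of_real pi * \<i> * of_real t))" for x and t :: real
  have F_eq: "F x y = integral (cbox 0 1) (\<lambda>t. K x t / (circlepath y0 r t - y))"
    if "x \<in> ?V" "y \<in> ball y0 r" for x y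
  proof -
    have "F x w = N x w / D x w" if "w \<in> sphere y0 r" for w
      using VD[OF \<open>x \<in> ?V\<close> that] eq[of x w] by (simp add: field_simps)
    then have "F x (circlepath y0 r t) = N x (circlepath y0 r t) / D x (circlepath y0 r t)" for t
      using circlepath_in_sphere[of r y0] r by auto
    then show ?thesis
      using circlepath_integrals(1)[OF holF _ that(2), of x] that VA by (auto simp: K_def)
  qed
  have contK: "continuous_on (?V \<times> cbox 0 1) (\<lambda>(x, t). K x t)"
  proof -
    have 1: "continuous_on (?V \<times> cbox 0 1) (\<lambda>p. (fst p, circlepath y0 r (snd p)))"
      by (intro continuous_intros continuous_on_compose2[OF continuous_on_circlepath]) auto
    have 2: "(\<lambda>p. (fst p, circlepath y0 r (snd p))) ` (?V \<times> cbox 0 1) \<subseteq> A \<times> UNIV"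
      using VA by auto
    have "continuous_on (?V \<times> cbox 0 1) (\<lambda>p. N (fst p) (circlepath y0 r (snd p)))"
      "continuous_on (?V \<times> cbox 0 1) (\<lambda>p. D (fst p) (circlepath y0 r (snd p)))"
      using continuous_on_compose2[OF contN 1 2] continuous_on_compose2[OF contD 1 2] by simp_all
    then show ?thesis
      unfolding K_def case_prod_beta using VD circlepath_in_sphere[of r y0] r
      by (intro continuous_intros) auto
  qed
  have "holomorphic2_on (\<lambda>(x, y). F x y) (?V \<times> ball y0 r)"
  proof (rule holomorphic2_on_Osgood)
    have "continuous_on (?V \<times> ball y0 r) (\<lambda>p. integral (cbox 0 1) (\<lambda>t. K (fst p) t / (circlepath y0 r t - snd p)))"
    proof (rule integral_continuous_on_param)
      have 1: "continuous_on ((?V \<times> ball y0 r) \<times> cbox 0 1) (\<lambda>q. (fst (fst q), snd q))"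
        by (intro continuous_intros)
      have 2: "(\<lambda>q. (fst (fst q), snd q)) ` ((?V \<times> ball y0 r) \<times> cbox 0 1) \<subseteq> ?V \<times> cbox 0 1"
        by auto
      have "continuous_on ((?V \<times> ball y0 r) \<times> cbox 0 1) (\<lambda>q. K (fst (fst q)) (snd q))"
        using continuous_on_compose2[OF contK 1 2] by simp
      moreover have "continuous_on ((?V \<times> ball y0 r) \<times> cbox 0 1) (\<lambda>q. circlepath y0 r (snd q))"
        by (intro continuous_intros continuous_on_compose2[OF continuous_on_circlepath]) auto
      ultimately show "continuous_on ((?V \<times> ball y0 r) \<times> cbox 0 1)
          (\<lambda>(p, t). K (fst p) t / (circlepath y0 r t - snd p))"
        unfolding case_prod_beta using circlepath_neq_ball by (intro continuous_intros) auto
    qed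
    then show "continuous_on (?V \<times> ball y0 r) (\<lambda>(x, y). F x y)"
      by (rule continuous_on_eq) (use F_eq in \<open>auto simp: case_prod_beta\<close>)
  next
    fix y assume y: "y \<in> ball y0 r"
    define G where "G x t = K x t / (circlepath y0 r t - y)" for x t
    have contG: "continuous_on (?V \<times> cbox 0 1) (\<lambda>(x, t). G x t)"
    proof -
      have "continuous_on (?V \<times> cbox 0 1) (\<lambda>q. circlepath y0 r (snd q))"
        by (intro continuous_intros continuous_on_compose2[OF continuous_on_circlepath]) auto
      then show ?thesis
        using contK circlepath_neq_ball[OF y] unfolding G_def case_prod_beta
        by (intro continuous_intros) auto
    qed
    have holG: "(\<lambda>x. G x t) holomorphic_on ?V" for t
      unfolding G_def K_def using VD circlepath_in_sphere[of r y0] r circlepath_neq_ball[OF y]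
      by (intro holomorphic_intros holomorphic_on_subset[OF holN VA] holomorphic_on_subset[OF holD VA]) auto
    have "(\<lambda>x. integral (cbox 0 1) (G x)) holomorphic_on ?V"
    proof (rule leibniz_rule_holomorphic)
      show "((\<lambda>x. G x t) has_field_derivative deriv (\<lambda>x. G x t) x) (at x within ?V)" if "x \<in> ?V" for x t
        using holomorphic_derivI[OF holG _ that] by (auto intro: has_field_derivative_at_within)
      show "G x integrable_on cbox 0 1" if "x \<in> ?V" for x
      proof -
        have 1: "continuous_on (cbox 0 1) (\<lambda>t. (x, t))"
          by (intro continuous_intros)
        have 2: "(\<lambda>t. (x, t)) ` cbox 0 1 \<subseteq> ?V \<times> cbox 0 1"
          using that by auto
        show ?thesis
          using continuous_on_compose2[OF contG 1 2] by (intro integrable_continuous) simp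
      qed
      show "continuous_on (?V \<times> cbox 0 1) (\<lambda>(x, t). deriv (\<lambda>x. G x t) x)"
        by (intro continuous_on_deriv_param contG holG) auto
    qed auto
    then show "(\<lambda>x. F x y) holomorphic_on ?V"
      by (rule holomorphic_transform) (use F_eq y in \<open>auto simp: G_def[abs_def]\<close>)
  qed (use VA holF holomorphic_on_subset in blast)+
  then show "\<exists>C D. ((\<lambda>(x, y). F x y) has_derivative (\<lambda>(u, v). C * u + D * v)) (at (x0, y0))"
    unfolding holomorphic2_on_def using d r by auto
qed

section \<open>Theta blocks and their divisors\<close>

text \<open>The number \<nu>(d) of the overview, integer-valued because its nonnegativity has to be
  derived from holomorphy.\<close>

definition divisor_excess :: "int list \<Rightarrow> int list \<Rightarrow> nat \<Rightarrow> int" where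
  "divisor_excess as bs d =
     int (length (filter (\<lambda>a. int d dvd a) as)) - int (length (filter (\<lambda>b. int d dvd b) bs))"

lemma period_lattice_0 [simp]: "0 \<in> period_lattice \<tau>"
  unfolding period_lattice_def mem_Collect_eq by (rule exI[of _ 0], rule exI[of _ 0]) simp

lemma period_lattice_diff:
  assumes "x \<in> period_lattice \<tau>" "y \<in> period_lattice \<tau>"
  shows "x - y \<in> period_lattice \<tau>"
proof -
  obtain m n m' n' where "x = of_int m + of_int n * \<tau>" "y = of_int m' + of_int n' * \<tau>"
    using assms by (auto simp: period_lattice_def)
  then have "x - y = of_int (m - m') + of_int (n - n') * \<tau>"
    by (simp add: algebra_simps)
  then show ?thesis unfolding period_lattice_def by blast
qed

lemma period_lattice_of_int_mult:
  assumes "x \<in> period_lattice \<tau>"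
  shows "of_int k * x \<in> period_lattice \<tau>"
proof -
  obtain m n where "x = of_int m + of_int n * \<tau>"
    using assms by (auto simp: period_lattice_def)
  then have "of_int k * x = of_int (k * m) + of_int (k * n) * \<tau>"
    by (simp add: algebra_simps)
  then show ?thesis unfolding period_lattice_def by blast
qed

text \<open>The integers that carry \<open>z\<close> into the lattice form an ideal: zero if
  \<open>z\<close> is not a torsion point, otherwise generated by its exact order
  \<open>d\<close>.\<close>

lemma period_lattice_multiples:
  obtains "\<And>a. a \<noteq> 0 \<Longrightarrow> of_int a * z \<notin> period_lattice \<tau>"
  | d where "d > 0" "\<And>a. of_int a * z \<in> period_lattice \<tau> \<longleftrightarrow> int d dvd a"
proof (cases "\<exists>d>0. of_int (int d) * z \<in> period_lattice \<tau>")
  case False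
  have "of_int a * z \<notin> period_lattice \<tau>" if "a \<noteq> 0" for a
  proof
    assume "of_int a * z \<in> period_lattice \<tau>"
    then have "of_int (sgn a) * (of_int a * z) \<in> period_lattice \<tau>"
      by (rule period_lattice_of_int_mult)
    also have "of_int (sgn a) * (of_int a * z) = of_int (int (nat \<bar>a\<bar>)) * z"
    proof -
      have "sgn a * a = int (nat \<bar>a\<bar>)" by (simp add: sgn_if)
      then show ?thesis by (metis mult.assoc of_int_mult)
    qed
    finally show False using False that by (metis zero_less_abs_iff zero_less_nat_eq)
  qed
  then show ?thesis using that(1) by blast
next
  case True
  define d where "d = (LEAST d. d > 0 \<and> of_int (int d) * z \<in> period_lattice \<tau>)"
  have d: "d > 0" "of_int (int d) * z \<in> period_lattice \<tau>"
    using LeastI_ex[OF True[unfolded Bex_def]] by (auto simp: d_def)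
  have "of_int a * z \<in> period_lattice \<tau> \<longleftrightarrow> int d dvd a" for a
  proof
    assume "int d dvd a"
    then obtain k where "a = k * int d" by (metis dvdE mult.commute)
    then have "of_int a * z = of_int k * (of_int (int d) * z)" by simp
    then show "of_int a * z \<in> period_lattice \<tau>"
      using period_lattice_of_int_mult[OF d(2)] by metis
  next
    assume a: "of_int a * z \<in> period_lattice \<tau>"
    define r where "r = a mod int d"
    have r: "0 \<le> r" "r < int d" using d(1) by (simp_all add: r_def)
    have "of_int r * z = of_int a * z - of_int (a div int d) * (of_int (int d) * z)"
    proof -
      have r_eq: "r = a - a div int d * int d" by (simp add: r_def minus_div_mult_eq_mod)
      show ?thesis unfolding r_eq by (simp add: algebra_simps)
    qed
    also have "\<dots> \<in> period_lattice \<tau>"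
      by (intro period_lattice_diff a period_lattice_of_int_mult d(2))
    finally have "of_int (int (nat r)) * z \<in> period_lattice \<tau>" using r by simp
    moreover have "nat r < d" using r d(1) by linarith
    ultimately have "nat r = 0"
      using not_less_Least[of "nat r" "\<lambda>d. d > 0 \<and> of_int (int d) * z \<in> period_lattice \<tau>"] by (auto simp: d_def)
    then show "int d dvd a" using r by (simp add: r_def dvd_eq_mod_eq_0)
  qed
  then show ?thesis using that(2) d(1) by blast
qed

text \<open>Comparing imaginary parts rules out a \<tau>-component, so membership reduces to
  divisibility of integers, for every \<tau> alike.\<close>

lemma torsion_point_multiple:
  assumes "\<tau> \<in> upper_half_plane" "d > 0"
  shows "of_int a * (1 / of_nat d) \<in> period_lattice \<tau> \<longleftrightarrow> int d dvd a"
proof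
  assume "of_int a * (1 / of_nat d) \<in> period_lattice \<tau>"
  then obtain m n where mn: "of_int a * (1 / of_nat d) = of_int m + of_int n * \<tau>"
    by (auto simp: period_lattice_def)
  have "Im (of_int a * (1 / of_nat d)) = of_int n * Im \<tau>"
    unfolding mn by simp
  moreover have "Im (of_int a * (1 / of_nat d) :: complex) = 0"
    by (simp add: Im_divide_of_nat)
  ultimately have "n = 0" using assms by (auto simp: upper_half_plane_def)
  then have "of_int a = (of_int (m * int d) :: complex)"
    using mn assms by (simp add: field_simps)
  then have "a = m * int d" by (simp only: of_int_eq_iff)
  then show "int d dvd a" by simp
next
  assume "int d dvd a"
  then obtain k where "a = int d * k" by blast
  then have "of_int a * (1 / of_nat d) = (of_int k + of_int 0 * \<tau>)"
    using assms by simp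
  then show "of_int a * (1 / of_nat d) \<in> period_lattice \<tau>"
    unfolding period_lattice_def by blast
qed

lemma filter_eq_Nil_of_nonzero:
  "(\<And>a. a \<noteq> 0 \<Longrightarrow> \<not> P a) \<Longrightarrow> 0 \<notin> set as \<Longrightarrow> filter P as = []"
  by (induction as) auto

text \<open>At a non-torsion point neither product vanishes; at a point of exact order
  \<open>d\<close> the two orders differ by the excess at \<open>d\<close>.\<close>

lemma zorder_theta_prod_le:
  assumes \<tau>: "\<tau> \<in> upper_half_plane" and nz: "0 \<notin> set as" "0 \<notin> set bs"
    and excess: "\<And>d. d > 0 \<Longrightarrow> divisor_excess as bs d \<ge> 0"
  shows "zorder (theta_prod bs \<tau>) z \<le> zorder (theta_prod as \<tau>) z"
proof (rule period_lattice_multiples[of z \<tau>])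
  assume *: "\<And>a. a \<noteq> 0 \<Longrightarrow> of_int a * z \<notin> period_lattice \<tau>"
  show ?thesis
    unfolding zorder_theta_prod[OF \<tau> nz(1)] zorder_theta_prod[OF \<tau> nz(2)]
    using filter_eq_Nil_of_nonzero[OF * nz(2)] by simp
next
  fix d assume d: "d > 0" "\<And>a. of_int a * z \<in> period_lattice \<tau> \<longleftrightarrow> int d dvd a"
  show ?thesis
    unfolding zorder_theta_prod[OF \<tau> nz(1)] zorder_theta_prod[OF \<tau> nz(2)] d(2)
    using excess[OF d(1)] by (simp add: divisor_excess_def)
qed

lemma zorder_theta_prod_torsion:
  assumes "\<tau> \<in> upper_half_plane" "0 \<notin> set as" "d > 0"
  shows "zorder (theta_prod as \<tau>) (1 / of_nat d) = int (length (filter (\<lambda>a. int d dvd a) as))"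
  unfolding zorder_theta_prod[OF assms(1,2)] torsion_point_multiple[OF assms(1,3)] ..

section \<open>Quotients of theta products and their orders\<close>

text \<open>\<open>remove_sings\<close> supplies the values at zeros of the denominator. It acts in
  z for each fixed \<tau>, so holomorphy in \<tau> is not built in.\<close>

definition theta_quotient :: "int list \<Rightarrow> int list \<Rightarrow> complex \<Rightarrow> complex \<Rightarrow> complex" where
  "theta_quotient as bs \<tau> = remove_sings (\<lambda>z. theta_prod as \<tau> z / theta_prod bs \<tau> z)"

text \<open>Nonnegative order of the quotient excludes poles, so every singularity is removable. The
  product equation holds off the zeros of \<open>g\<close> and extends to them by
  continuity.\<close>

lemma entire_quotient:
  assumes f: "f holomorphic_on UNIV" "\<And>z. eventually (\<lambda>w. f w \<noteq> 0) (at z)"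
    and g: "g holomorphic_on UNIV" "\<And>z. eventually (\<lambda>w. g w \<noteq> 0) (at z)"
    and ord: "\<And>z. zorder g z \<le> zorder f z"
  shows "remove_sings (\<lambda>z. f z / g z) holomorphic_on UNIV"
    and "remove_sings (\<lambda>z. f z / g z) z * g z = f z"
proof -
  let ?h = "\<lambda>z. f z / g z"
  have ana: "f analytic_on A" "g analytic_on A" for A
    using f(1) g(1) analytic_on_holomorphic by blast+
  have mero: "?h meromorphic_on A" for A
    using ana by (intro meromorphic_intros analytic_on_imp_meromorphic_on)
  have iso: "isolated_singularity_at ?h z" and ness: "not_essential ?h z" for z
    using mero[of "{z}"] by (auto simp: meromorphic_at_iff)
  have ana_h: "remove_sings ?h analytic_on {z}" for z
  proof -
    have "zorder ?h z = zorder f z - zorder g z"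
      using ana f(2) g(2) by (intro zorder_divide analytic_on_imp_meromorphic_on eventually_frequently) auto
    then have "\<not> is_pole ?h z"
      using isolated_pole_imp_neg_zorder[OF iso, of z] ord[of z] by auto
    then obtain c where "?h \<midarrow>z\<rightarrow> c"
      using ness[of z] by (auto simp: not_essential_def)
    then show ?thesis by (rule remove_sings_analytic_at[OF iso])
  qed
  then have "remove_sings ?h analytic_on UNIV"
    using analytic_on_analytic_at by blast
  then show hol: "remove_sings ?h holomorphic_on UNIV"
    using analytic_imp_holomorphic by blast
  show "remove_sings ?h z * g z = f z"
  proof (rule tendsto_unique[of "at z"])
    have cont: "continuous_on UNIV f"
      using f(1) by (rule holomorphic_on_imp_continuous_on)
    have "continuous_on UNIV (\<lambda>w. remove_sings ?h w * g w)"
      by (intro continuous_on_mult holomorphic_on_imp_continuous_on hol g(1))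
    then show "((\<lambda>w. remove_sings ?h w * g w) \<longlongrightarrow> remove_sings ?h z * g z) (at z)"
      by (simp add: continuous_on_def)
    have f_lim: "(f \<longlongrightarrow> f z) (at z)"
      using cont by (simp add: continuous_on_def)
    have "eventually (\<lambda>w. remove_sings ?h w = ?h w) (at z)"
      by (rule eventually_remove_sings_eq_at[OF iso])
    with g(2)[of z] have "eventually (\<lambda>w. f w = remove_sings ?h w * g w) (at z)"
      by eventually_elim simp
    then show "((\<lambda>w. remove_sings ?h w * g w) \<longlongrightarrow> f z) (at z)"
      using f_lim by (rule Lim_transform_eventually[rotated])
  qed simp
qed

lemma continuous_on_theta_prod:
  "continuous_on (upper_half_plane \<times> UNIV) (\<lambda>(\<tau>, z). theta_prod as \<tau> z)"
proof (induction as)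
  case (Cons a as)
  have 1: "continuous_on (upper_half_plane \<times> UNIV) (\<lambda>p. (fst p, of_int a * snd p :: complex))"
    by (intro continuous_intros)
  have 2: "(\<lambda>p. (fst p, of_int a * snd p)) ` (upper_half_plane \<times> UNIV) \<subseteq> upper_half_plane \<times> UNIV"
    by auto
  from continuous_on_compose2[OF continuous_on_theta 1 2]
  have "continuous_on (upper_half_plane \<times> UNIV) (\<lambda>p. theta (fst p) (of_int a * snd p))"
    by simp
  from continuous_on_mult[OF this Cons.IH] show ?case
    by (simp add: case_prod_unfold)
qed (simp add: case_prod_unfold)

lemma holomorphic_on_theta_prod_tau: "(\<lambda>\<tau>. theta_prod as \<tau> z) holomorphic_on upper_half_plane"
  by (induction as) (auto intro!: holomorphic_intros holomorphic_on_theta_tau)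

text \<open>\<open>holomorphic2_on_quotient\<close> upgrades the slicewise quotients to joint
  holomorphy. Exponent 0 suffices because classes ignore powers of \<open>eta\<close>.\<close>

lemma theta_quotient_block_data:
  assumes nz: "0 \<notin> set as" "0 \<notin> set bs"
    and excess: "\<And>d. d > 0 \<Longrightarrow> divisor_excess as bs d \<ge> 0"
  shows "generalized_theta_block_data (\<lambda>(\<tau>, z). theta_quotient as bs \<tau> z) 0 as bs"
proof -
  have q: "theta_quotient as bs \<tau> holomorphic_on UNIV"
      "theta_quotient as bs \<tau> z * theta_prod bs \<tau> z = theta_prod as \<tau> z" if "\<tau> \<in> upper_half_plane" for \<tau> z
    unfolding theta_quotient_def
    using that nz excess
    by (intro entire_quotient holomorphic_on_theta_prod eventually_theta_prod_nonzero zorder_theta_prod_le; simp)+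
  have "holomorphic2_on (\<lambda>(\<tau>, z). theta_quotient as bs \<tau> z) (upper_half_plane \<times> UNIV)"
    using eventually_theta_prod_nonzero nz
    by (intro holomorphic2_on_quotient[OF open_upper_half_plane continuous_on_theta_prod continuous_on_theta_prod
       holomorphic_on_theta_prod_tau holomorphic_on_theta_prod_tau _ q]) auto
  then show ?thesis
    using nz q by (simp add: generalized_theta_block_data_def theta_prod_def)
qed

lemma block_data_holomorphic_slice:
  assumes "generalized_theta_block_data f n as bs" "\<tau> \<in> upper_half_plane"
  shows "(\<lambda>z. f (\<tau>, z)) holomorphic_on UNIV"
  unfolding holomorphic_on_def
proof
  fix z
  obtain A B where "(f has_derivative (\<lambda>(u, v). A * u + B * v)) (at (\<tau>, z))"
    using assms unfolding generalized_theta_block_data_def holomorphic2_on_def by fast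
  moreover have "(Pair \<tau> has_derivative (\<lambda>v. (0, v))) (at z)"
    by (auto intro!: derivative_eq_intros)
  ultimately have "((\<lambda>z. f (\<tau>, z)) has_derivative (\<lambda>v. case (0, v) of (u, v) \<Rightarrow> A * u + B * v)) (at z)"
    by (rule has_derivative_compose[rotated])
  then have "((\<lambda>z. f (\<tau>, z)) has_field_derivative B) (at z)"
    by (simp add: has_field_derivative_def)
  then show "(\<lambda>z. f (\<tau>, z)) field_differentiable at z within UNIV"
    unfolding field_differentiable_def by auto
qed

lemma eta_nonzero:
  assumes "\<tau> \<in> upper_half_plane"
  shows "eta \<tau> \<noteq> 0"
proof -
  obtain L where L: "qpoch (e_pow 1 \<tau>) \<longlonglongrightarrow> L" "L \<noteq> 0"
    using qpoch_tendsto[OF norm_nome_less_1[OF assms]] .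
  have "(\<lambda>n. \<Prod>k\<le>n. 1 - e_pow 1 \<tau> ^ Suc k) \<longlonglongrightarrow> L"
    using LIMSEQ_Suc[OF L(1)] by (simp add: qpoch_def lessThan_Suc_atMost)
  then have "(\<lambda>k. 1 - e_pow 1 \<tau> ^ Suc k) has_prod L"
    using L(2) by (simp add: has_prod_def raw_has_prod_def)
  then have "(\<Prod>k. 1 - e_pow 1 \<tau> ^ Suc k) = L"
    using has_prod_unique by blast
  then show ?thesis using L(2) by (simp add: eta_def)
qed

lemma block_data_eq:
  assumes "generalized_theta_block_data f n as bs" "\<tau> \<in> upper_half_plane"
  shows "f (\<tau>, z) * theta_prod bs \<tau> z = eta \<tau> powi n * theta_prod as \<tau> z"
  using assms by (simp add: generalized_theta_block_data_def theta_prod_def)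

lemma block_data_eventually_nonzero:
  assumes f: "generalized_theta_block_data f n as bs" and \<tau>: "\<tau> \<in> upper_half_plane"
  shows "eventually (\<lambda>w. f (\<tau>, w) \<noteq> 0) (at z)"
proof -
  have "0 \<notin> set as" using f by (simp add: generalized_theta_block_data_def)
  from eventually_theta_prod_nonzero[OF \<tau> this, of z] show ?thesis
  proof eventually_elim
    case (elim w)
    then show ?case using block_data_eq[OF f \<tau>, of w] eta_nonzero[OF \<tau>] by auto
  qed
qed

text \<open>Orders are compared in the equation with cleared denominators, which is valid also at
  zeros of the denominator. For fixed \<tau> the power of \<open>eta\<close> is a nonzero
  constant.\<close>

lemma zorder_block_torsion:
  assumes f: "generalized_theta_block_data f n as bs" and \<tau>: "\<tau> \<in> upper_half_plane" and d: "d > 0"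
  shows "zorder (\<lambda>z. f (\<tau>, z)) (1 / of_nat d) = divisor_excess as bs d"
proof -
  let ?z = "1 / of_nat d :: complex"
  have nz: "0 \<notin> set as" "0 \<notin> set bs"
    using f by (simp_all add: generalized_theta_block_data_def)
  have ana: "(\<lambda>z. f (\<tau>, z)) analytic_on {?z}"
    using block_data_holomorphic_slice[OF f \<tau>] analytic_on_holomorphic by blast
  have "eventually (\<lambda>w. f (\<tau>, w) * theta_prod bs \<tau> w \<noteq> 0) (at ?z)"
    using block_data_eventually_nonzero[OF f \<tau>, of ?z] eventually_theta_prod_nonzero[OF \<tau> nz(2), of ?z]
    by eventually_elim simp
  then have "zorder (\<lambda>w. f (\<tau>, w) * theta_prod bs \<tau> w) ?z = zorder (\<lambda>z. f (\<tau>, z)) ?z + zorder (theta_prod bs \<tau>) ?z"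
    by (rule zorder_times_analytic[OF ana analytic_on_theta_prod[OF \<tau>]])
  moreover have "zorder (\<lambda>w. f (\<tau>, w) * theta_prod bs \<tau> w) ?z = zorder (theta_prod as \<tau>) ?z"
    unfolding block_data_eq[OF f \<tau>] using eta_nonzero[OF \<tau>] by (intro zorder_cmult) simp
  ultimately show ?thesis
    unfolding zorder_theta_prod_torsion[OF \<tau> nz(1) d] zorder_theta_prod_torsion[OF \<tau> nz(2) d]
    by (simp add: divisor_excess_def)
qed

text \<open>The excess does not depend on \<tau>, so the slice at \<tau> = i decides.\<close>

lemma block_data_divisor_excess_nonneg:
  assumes f: "generalized_theta_block_data f n as bs" and d: "d > 0"
  shows "divisor_excess as bs d \<ge> 0"
proof -
  have \<tau>: "\<i> \<in> upper_half_plane" by (simp add: upper_half_plane_def)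
  have "(\<lambda>z. f (\<i>, z)) analytic_on {1 / of_nat d}"
    using block_data_holomorphic_slice[OF f \<tau>] analytic_on_holomorphic by blast
  then have "zorder (\<lambda>z. f (\<i>, z)) (1 / of_nat d) \<ge> 0"
    using block_data_eventually_nonzero[OF f \<tau>, of "1 / of_nat d"]
    by (intro zorder_ge_0) (auto intro: eventually_frequently)
  then show ?thesis unfolding zorder_block_torsion[OF f \<tau> d] .
qed

section \<open>The excess as a complete invariant of a class\<close>

lemma theta_minus: "theta \<tau> (-z) = - theta \<tau> z"
proof -
  let ?f = "\<lambda>r z. kronecker_m4 r * e_pow (of_int r ^ 2 / 8) \<tau> * e_pow (of_int r / 2) z"
  have "?f r (-z) = - ?f (-r) z" for r
  proof -
    have "(- r) mod 4 = 1 \<longleftrightarrow> r mod 4 \<noteq> 1" if "odd r"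
    proof -
      have "r mod 4 = 1 \<or> r mod 4 = 3" using that by presburger
      then show ?thesis by (auto simp: zmod_zminus1_eq_if)
    qed
    then have "kronecker_m4 (-r) = - kronecker_m4 r"
      by (auto simp: kronecker_m4_def)
    moreover have "e_pow (of_int r / 2) (-z) = e_pow (of_int (- r) / 2) z"
      by (simp add: e_pow_def)
    ultimately show ?thesis by simp
  qed
  then have "theta \<tau> (-z) = (\<Sum>\<^sub>\<infinity>r. - ?f (-r) z)"
    unfolding theta_def by simp
  also have "\<dots> = - (\<Sum>\<^sub>\<infinity>r. ?f (-r) z)"
    by (rule infsum_uminus)
  also have "(\<Sum>\<^sub>\<infinity>r. ?f (-r) z) = theta \<tau> z"
    unfolding theta_def
    by (rule infsum_reindex_bij_witness[of _ uminus uminus]) auto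
  finally show ?thesis .
qed

lemma eta_power_relI:
  assumes "s \<in> {1, -1}"
    and "\<And>\<tau> z. \<tau> \<in> upper_half_plane \<Longrightarrow> g (\<tau>, z) = s * eta \<tau> powi k * f (\<tau>, z)"
  shows "(f, g) \<in> eta_power_rel"
  using assms unfolding eta_power_rel_def by blast

lemma eta_power_relE:
  assumes "(f, g) \<in> eta_power_rel"
  obtains k s where "s \<in> {1, -1}"
    "\<And>\<tau> z. \<tau> \<in> upper_half_plane \<Longrightarrow> g (\<tau>, z) = s * eta \<tau> powi k * f (\<tau>, z)"
  using assms unfolding eta_power_rel_def by blast

definition sign_prod :: "int list \<Rightarrow> complex" where
  "sign_prod as = (\<Prod>a\<leftarrow>as. if a < 0 then -1 else 1)"

lemma sign_prod_in: "sign_prod as \<in> {1, -1}"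
  by (induction as) (auto simp: sign_prod_def)

text \<open>Divisibility does not see signs. Since theta is odd, the entries can be replaced by the
  multiset of their absolute values at the cost of one global sign.\<close>

lemma theta_prod_abs:
  "theta_prod as \<tau> z = sign_prod as * (\<Prod>a\<in>#mset (map (nat \<circ> abs) as). theta \<tau> (of_nat a * z))"
proof (induction as)
  case (Cons a as)
  have "theta \<tau> (of_int a * z) = (if a < 0 then -1 else 1) * theta \<tau> (of_nat (nat \<bar>a\<bar>) * z)"
    using theta_minus[of \<tau> "of_int \<bar>a\<bar> * z"] by auto
  then show ?case using Cons.IH by (simp add: sign_prod_def mult_ac)
qed (simp add: sign_prod_def)

text \<open>Both multisets have the same maximum: each element of one divides some element of the other.\<close>

lemma multiset_eq_of_multiples_count_eq:
  fixes A B :: "nat multiset"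
  assumes "0 \<notin># A" "0 \<notin># B"
    and "\<And>d. d > 0 \<Longrightarrow> size (filter_mset (\<lambda>a. d dvd a) A) = size (filter_mset (\<lambda>a. d dvd a) B)"
  shows "A = B"
  using assms
proof (induction "size A" arbitrary: A B rule: less_induct)
  case less
  have ex: "\<exists>b\<in>#Y. d dvd b"
    if "d \<in># X" "0 \<notin># X" "\<And>d. d > 0 \<Longrightarrow> size (filter_mset (\<lambda>a. d dvd a) X) = size (filter_mset (\<lambda>a. d dvd a) Y)"
    for X Y :: "nat multiset" and d
  proof -
    have "d > 0" using that(1,2) by (cases d) auto
    moreover have "d \<in># filter_mset (\<lambda>a. d dvd a) X" using that(1) by simp
    ultimately have "filter_mset (\<lambda>a. d dvd a) Y \<noteq> {#}"
      using that(3) by (metis empty_not_add_mset multi_member_split size_eq_0_iff_empty)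
    then obtain b where "b \<in># filter_mset (\<lambda>a. d dvd a) Y" by blast
    then show ?thesis by auto
  qed
  show ?case
  proof (cases "A = {#}")
    case True
    have "B = {#}"
    proof (rule ccontr)
      assume "B \<noteq> {#}"
      then obtain b where "b \<in># B" by blast
      then show False using ex[of b B A] less.prems True by auto
    qed
    then show ?thesis using True by simp
  next
    case False
    define M where "M = Max (set_mset A)"
    have M: "M \<in># A" "\<And>a. a \<in># A \<Longrightarrow> a \<le> M"
      using False by (auto simp: M_def)
    obtain b where b: "b \<in># B" "M dvd b"
      using ex[OF M(1) less.prems(1,3)] by blast
    obtain a where a: "a \<in># A" "b dvd a"
      using ex[OF b(1) less.prems(2)] less.prems(3) by metis
    have "a > 0" "b > 0" using a b less.prems by (metis neq0_conv)+
    then have "b \<le> a" "M \<le> b" using a b by (auto intro: dvd_imp_le)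
    then have "b = M" using M(2)[OF a(1)] by simp
    then obtain A' B' where AB: "A = add_mset M A'" "B = add_mset M B'"
      using M(1) b(1) by (metis mset_add)
    have "A' = B'"
    proof (rule less.hyps)
      show "size (filter_mset (\<lambda>a. d dvd a) A') = size (filter_mset (\<lambda>a. d dvd a) B')" if "d > 0" for d
        using less.prems(3)[OF that] by (simp add: AB split: if_splits)
    qed (use less.prems AB in auto)
    then show ?thesis by (simp add: AB)
  qed
qed

lemma size_filter_mset_abs:
  "size (filter_mset (\<lambda>a. d dvd a) (mset (map (nat \<circ> abs) as))) = length (filter (\<lambda>a. int d dvd a) as)"
  by (induction as) (auto simp: nat_dvd_iff)

text \<open>Moving the denominators across turns equal excesses into equal divisor counts for
  \<open>as @ bs'\<close> and \<open>as' @ bs\<close>, so nothing is divided by a theta product that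
  may vanish.\<close>

lemma divisor_excess_determines_theta_prod:
  assumes nz: "0 \<notin> set as" "0 \<notin> set bs" "0 \<notin> set as'" "0 \<notin> set bs'"
    and eq: "\<And>d. d > 0 \<Longrightarrow> divisor_excess as bs d = divisor_excess as' bs' d"
  obtains s where "s \<in> {1, -1}"
    "\<And>\<tau> z. theta_prod as' \<tau> z * theta_prod bs \<tau> z = s * (theta_prod as \<tau> z * theta_prod bs' \<tau> z)"
proof -
  let ?m = "\<lambda>as. mset (map (nat \<circ> abs) as)"
  have "?m (as @ bs') = ?m (as' @ bs)"
  proof (rule multiset_eq_of_multiples_count_eq)
    show "size (filter_mset (\<lambda>a. d dvd a) (?m (as @ bs'))) = size (filter_mset (\<lambda>a. d dvd a) (?m (as' @ bs)))"
      if "d > 0" for d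
      unfolding size_filter_mset_abs using eq[OF that] by (simp add: divisor_excess_def)
  qed (use nz in auto)
  then have m: "?m as + ?m bs' = ?m as' + ?m bs" by simp
  define s where "s = sign_prod as * sign_prod bs * sign_prod as' * sign_prod bs'"
  have "s \<in> {1, -1}"
    using sign_prod_in[of as] sign_prod_in[of bs] sign_prod_in[of as'] sign_prod_in[of bs']
    by (auto simp: s_def)
  moreover have "theta_prod as' \<tau> z * theta_prod bs \<tau> z = s * (theta_prod as \<tau> z * theta_prod bs' \<tau> z)" for \<tau> z
  proof -
    let ?P = "\<lambda>A. \<Prod>a\<in>#A. theta \<tau> (of_nat a * z)"
    have "?P (?m as) * ?P (?m bs') = ?P (?m as') * ?P (?m bs)"
      using arg_cong[OF m, of ?P] by simp
    moreover have "sign_prod x * sign_prod x = 1" for x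
      using sign_prod_in[of x] by auto
    ultimately show ?thesis
      unfolding theta_prod_abs s_def
      by (smt (verit) mult.assoc mult.commute mult_1)
  qed
  ultimately show ?thesis using that by blast
qed

text \<open>The denominators can be cancelled only where both are nonzero, which holds near
  \<open>z\<close> but perhaps not at \<open>z\<close>; continuity supplies the value there.\<close>

lemma blocks_with_equal_excess_related:
  assumes f: "generalized_theta_block_data f n as bs" and g: "generalized_theta_block_data g n' as' bs'"
    and eq: "\<And>d. d > 0 \<Longrightarrow> divisor_excess as bs d = divisor_excess as' bs' d"
  shows "(f, g) \<in> eta_power_rel"
proof -
  have nz: "0 \<notin> set as" "0 \<notin> set bs" "0 \<notin> set as'" "0 \<notin> set bs'"
    using f g by (simp_all add: generalized_theta_block_data_def)
  obtain s where s: "s \<in> {1, -1}"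
    "\<And>\<tau> z. theta_prod as' \<tau> z * theta_prod bs \<tau> z = s * (theta_prod as \<tau> z * theta_prod bs' \<tau> z)"
    using divisor_excess_determines_theta_prod[OF nz eq] by blast
  have "g (\<tau>, z) = s * eta \<tau> powi (n' - n) * f (\<tau>, z)" if \<tau>: "\<tau> \<in> upper_half_plane" for \<tau> z
  proof (rule tendsto_unique[of "at z"])
    have "continuous_on UNIV (\<lambda>w. g (\<tau>, w))" "continuous_on UNIV (\<lambda>w. f (\<tau>, w))"
      using block_data_holomorphic_slice[OF f \<tau>] block_data_holomorphic_slice[OF g \<tau>]
      by (auto intro: holomorphic_on_imp_continuous_on)
    then have lim: "((\<lambda>w. g (\<tau>, w)) \<longlongrightarrow> g (\<tau>, z)) (at z)" "((\<lambda>w. f (\<tau>, w)) \<longlongrightarrow> f (\<tau>, z)) (at z)"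
      by (auto simp: continuous_on_def)
    show "((\<lambda>w. g (\<tau>, w)) \<longlongrightarrow> g (\<tau>, z)) (at z)" by (rule lim(1))
    have "eventually (\<lambda>w. s * eta \<tau> powi (n' - n) * f (\<tau>, w) = g (\<tau>, w)) (at z)"
      using eventually_theta_prod_nonzero[OF \<tau> nz(2), of z] eventually_theta_prod_nonzero[OF \<tau> nz(4), of z]
    proof eventually_elim
      case (elim w)
      let ?D = "theta_prod bs \<tau> w" and ?D' = "theta_prod bs' \<tau> w"
      have "eta \<tau> powi n' = eta \<tau> powi (n' - n) * eta \<tau> powi n"
        using eta_nonzero[OF \<tau>] by (simp flip: power_int_add)
      then have "g (\<tau>, w) * ?D' * ?D = eta \<tau> powi (n' - n) * eta \<tau> powi n * (theta_prod as' \<tau> w * ?D)"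
        using block_data_eq[OF g \<tau>, of w] by (simp add: mult_ac)
      also have "\<dots> = s * eta \<tau> powi (n' - n) * (eta \<tau> powi n * theta_prod as \<tau> w) * ?D'"
        unfolding s(2) by (simp add: mult_ac)
      also have "\<dots> = s * eta \<tau> powi (n' - n) * f (\<tau>, w) * ?D' * ?D"
        unfolding block_data_eq[OF f \<tau>, of w, symmetric] by (simp add: mult_ac)
      finally show ?case using elim by simp
    qed
    moreover have "((\<lambda>w. s * eta \<tau> powi (n' - n) * f (\<tau>, w)) \<longlongrightarrow> s * eta \<tau> powi (n' - n) * f (\<tau>, z)) (at z)"
      by (intro tendsto_intros lim)
    ultimately show "((\<lambda>w. g (\<tau>, w)) \<longlongrightarrow> s * eta \<tau> powi (n' - n) * f (\<tau>, z)) (at z)"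
      by (rule Lim_transform_eventually[rotated])
  qed simp
  with s(1) show ?thesis by (rule eta_power_relI)
qed

lemma related_blocks_equal_excess:
  assumes f: "generalized_theta_block_data f n as bs" and g: "generalized_theta_block_data g n' as' bs'"
    and rel: "(f, g) \<in> eta_power_rel" and d: "d > 0"
  shows "divisor_excess as bs d = divisor_excess as' bs' d"
proof -
  have \<tau>: "\<i> \<in> upper_half_plane" by (simp add: upper_half_plane_def)
  obtain k :: int and s :: complex where s: "s \<in> {1, -1}"
     "\<And>z. g (\<i>, z) = s * eta \<i> powi k * f (\<i>, z)"
    using rel \<tau> by (elim eta_power_relE) blast
  have "divisor_excess as' bs' d = zorder (\<lambda>z. s * eta \<i> powi k * f (\<i>, z)) (1 / of_nat d)"
    unfolding zorder_block_torsion[OF g \<tau> d, symmetric] s(2) ..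
  also have "\<dots> = divisor_excess as bs d"
    unfolding zorder_block_torsion[OF f \<tau> d, symmetric]
    using s(1) eta_nonzero[OF \<tau>] by (intro zorder_cmult) auto
  finally show ?thesis ..
qed

text \<open>Triangular elimination from the largest element of the support, in place of Moebius inversion.\<close>

lemma exists_lists_with_divisor_excess:
  assumes "\<And>d. d \<notin> {1..N} \<Longrightarrow> \<nu> d = 0"
  shows "\<exists>as bs. 0 \<notin> set as \<and> 0 \<notin> set bs \<and> (\<forall>d>0. divisor_excess as bs d = \<nu> d)"
  using assms
proof (induction N arbitrary: \<nu>)
  case 0
  then show ?case by (intro exI[of _ "[]"]) (simp add: divisor_excess_def)
next
  case (Suc N)
  define k where "k = \<nu> (Suc N)"
  \<comment> \<open>\<open>k\<close> factors with entry \<open>Suc N\<close>, placed in the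
    denominator if \<open>k\<close> is negative, add \<open>k\<close> at every divisor of
    \<open>Suc N\<close>. Removing them clears the top of the support.\<close>
  define \<nu>' where "\<nu>' d = \<nu> d - (if d > 0 \<and> d dvd Suc N then k else 0)" for d
  have "\<nu>' d = 0" if "d \<notin> {1..N}" for d
  proof -
    consider "d = 0" | "d = Suc N" | "d > Suc N" using \<open>d \<notin> {1..N}\<close> by fastforce
    then show ?thesis
    proof cases
      case 3
      then have "\<not> d dvd Suc N" using dvd_imp_le by fastforce
      then show ?thesis using 3 Suc.prems by (simp add: \<nu>'_def)
    qed (use Suc.prems in \<open>auto simp: \<nu>'_def k_def\<close>)
  qed
  then obtain as bs where ab: "0 \<notin> set as" "0 \<notin> set bs" "\<And>d. d > 0 \<Longrightarrow> divisor_excess as bs d = \<nu>' d"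
    using Suc.IH by blast
  \<comment> \<open>At most one of \<open>nat k\<close> and \<open>nat (-k)\<close> is nonzero, so
    only one of the lists is extended.\<close>
  have "divisor_excess (replicate (nat k) (int (Suc N)) @ as) (replicate (nat (-k)) (int (Suc N)) @ bs) d = \<nu> d"
    if "d > 0" for d
  proof -
    have "divisor_excess (replicate (nat k) (int (Suc N)) @ as) (replicate (nat (-k)) (int (Suc N)) @ bs) d
        = divisor_excess as bs d + (if d dvd Suc N then k else 0)"
      by (auto simp: divisor_excess_def filter_replicate simp del: of_nat_Suc)
    then show ?thesis using ab(3)[OF that] that by (simp add: \<nu>'_def)
  qed
  then show ?case
    using ab(1,2) by (intro exI[of _ "replicate (nat k) (int (Suc N)) @ as"]
        exI[of _ "replicate (nat (-k)) (int (Suc N)) @ bs"]) auto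
qed

section \<open>The index as a weighted sum of orders\<close>

abbreviation (input) block_weight :: "nat \<Rightarrow> nat" where
  "block_weight a \<equiv> totient a * dedekind_psi a"

text \<open>Double counting: each square is the total weight of the divisors of its root, and the
  two sums are exchanged. \<open>N\<close> is a free bound so that numerator and denominator share
  one range.\<close>

lemma sum_squares_conv_divisor_counts:
  assumes "0 \<notin> set as" "\<And>a. a \<in> set as \<Longrightarrow> nat \<bar>a\<bar> \<le> N"
  shows "(\<Sum>a\<leftarrow>as. a\<^sup>2) = (\<Sum>d=1..N. int (block_weight d) * int (length (filter (\<lambda>a. int d dvd a) as)))"
  using assms
proof (induction as)
  case (Cons a as)
  have a: "nat \<bar>a\<bar> > 0" "nat \<bar>a\<bar> \<le> N" using Cons.prems by auto
  have "int (nat \<bar>a\<bar>) ^ 2 = int (\<Sum>d | d dvd nat \<bar>a\<bar>. block_weight d)"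
    using sum_divisors_totient_dedekind_psi[OF a(1)] by (simp del: of_nat_sum)
  then have "a ^ 2 = int (\<Sum>d | d dvd nat \<bar>a\<bar>. block_weight d)"
    by simp
  also have "{d. d dvd nat \<bar>a\<bar>} = {d \<in> {1..N}. int d dvd a}"
  proof (rule Set.set_eqI)
    fix d
    have "int d dvd a \<longleftrightarrow> d dvd nat \<bar>a\<bar>"
      using int_dvd_int_iff[of d "nat \<bar>a\<bar>"] by simp
    moreover have "d \<in> {1..N}" if "d dvd nat \<bar>a\<bar>"
      using dvd_imp_le[OF that a(1)] dvd_pos_nat[OF a(1) that] a(2) by simp
    ultimately show "d \<in> {d. d dvd nat \<bar>a\<bar>} \<longleftrightarrow> d \<in> {d \<in> {1..N}. int d dvd a}"
      by blast
  qed
  also have "int (\<Sum>d \<in> {d \<in> {1..N}. int d dvd a}. block_weight d) = (\<Sum>d=1..N. int (block_weight d) * (if int d dvd a then 1 else 0))"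
    unfolding of_nat_sum by (subst sum.inter_filter) (auto intro!: sum.cong)
  finally have "a ^ 2 = (\<Sum>d=1..N. int (block_weight d) * (if int d dvd a then 1 else 0))" .
  moreover have "(\<Sum>a\<leftarrow>as. a\<^sup>2) = (\<Sum>d=1..N. int (block_weight d) * int (length (filter (\<lambda>a. int d dvd a) as)))"
    using Cons by simp
  ultimately show ?case
    by (simp add: sum.distrib[symmetric] if_distrib cong: if_cong) (auto intro!: sum.cong simp: algebra_simps)
qed simp

lemma theta_block_index_conv_divisor_excess:
  assumes "0 \<notin> set as" "0 \<notin> set bs" "\<And>a. a \<in> set as \<union> set bs \<Longrightarrow> nat \<bar>a\<bar> \<le> N"
  shows "2 * theta_block_index as bs = of_int (\<Sum>d=1..N. int (block_weight d) * divisor_excess as bs d)"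
proof -
  have "(\<Sum>d=1..N. int (block_weight d) * divisor_excess as bs d) = (\<Sum>a\<leftarrow>as. a\<^sup>2) - (\<Sum>b\<leftarrow>bs. b\<^sup>2)"
    using assms
    by (subst (1 2) sum_squares_conv_divisor_counts[of _ N])
      (auto simp: divisor_excess_def sum_subtractf right_diff_distrib)
  then show ?thesis by (simp add: theta_block_index_def)
qed

text \<open>Symmetry and transitivity invert and combine powers of \<open>eta\<close>, which has no
  zeros in the upper half plane; signs are their own inverses.\<close>

lemma equiv_eta_power_rel: "equiv UNIV eta_power_rel"
proof (rule equivI)
  show "refl eta_power_rel"
    by (intro refl_onI eta_power_relI[of 1 _ 0]) auto
  show "sym eta_power_rel"
  proof (rule symI)
    fix f g assume "(f, g) \<in> eta_power_rel"
    then obtain k s where s: "s \<in> {1, -1}"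
       "\<And>\<tau> z. \<tau> \<in> upper_half_plane \<Longrightarrow> g (\<tau>, z) = s * eta \<tau> powi k * f (\<tau>, z)"
      by (elim eta_power_relE) blast
    have "f (\<tau>, z) = s * eta \<tau> powi (- k) * g (\<tau>, z)" if "\<tau> \<in> upper_half_plane" for \<tau> z
      using s(1) s(2)[OF that, of z] eta_nonzero[OF that] by (auto simp: power_int_minus field_simps)
    with s(1) show "(g, f) \<in> eta_power_rel"
      by (rule eta_power_relI)
  qed
  show "trans eta_power_rel"
  proof (rule transI)
    fix f g h assume fg: "(f, g) \<in> eta_power_rel" and gh: "(g, h) \<in> eta_power_rel"
    obtain k s where s: "s \<in> {1, -1}"
       "\<And>\<tau> z. \<tau> \<in> upper_half_plane \<Longrightarrow> g (\<tau>, z) = s * eta \<tau> powi k * f (\<tau>, z)"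
      using fg by (elim eta_power_relE) blast
    obtain l t where t: "t \<in> {1, -1}"
       "\<And>\<tau> z. \<tau> \<in> upper_half_plane \<Longrightarrow> h (\<tau>, z) = t * eta \<tau> powi l * g (\<tau>, z)"
      using gh by (elim eta_power_relE) blast
    have "h (\<tau>, z) = (s * t) * eta \<tau> powi (k + l) * f (\<tau>, z)" if "\<tau> \<in> upper_half_plane" for \<tau> z
      using s(2)[OF that, of z] t(2)[OF that, of z] eta_nonzero[OF that] by (simp add: power_int_add mult_ac)
    moreover have "s * t \<in> {1, -1}" using s(1) t(1) by auto
    ultimately show "(f, h) \<in> eta_power_rel"
      by (rule eta_power_relI[rotated])
  qed
qed auto

section \<open>Classes of blocks and weighted compositions\<close>

text \<open>Lists representing \<open>f\<close> are not unique, hence the existential. The excess at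
  0 is left unconstrained, so the value of \<nu> there is fixed to make \<nu> unique.\<close>

definition has_excess :: "(complex \<times> complex \<Rightarrow> complex) \<Rightarrow> (nat \<Rightarrow> nat) \<Rightarrow> bool" where
  "has_excess f \<nu> \<longleftrightarrow> (\<exists>n as bs. generalized_theta_block_data f n as bs \<and> \<nu> 0 = 0 \<and>
     (\<forall>d>0. divisor_excess as bs d = int (\<nu> d)))"

lemma has_excess_related_iff:
  assumes "has_excess f \<nu>" "has_excess g \<nu>'"
  shows "(f, g) \<in> eta_power_rel \<longleftrightarrow> \<nu> = \<nu>'"
proof -
  obtain n as bs n' as' bs' where
    f: "generalized_theta_block_data f n as bs" "\<nu> 0 = 0" "\<And>d. d > 0 \<Longrightarrow> divisor_excess as bs d = int (\<nu> d)" and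
    g: "generalized_theta_block_data g n' as' bs'" "\<nu>' 0 = 0" "\<And>d. d > 0 \<Longrightarrow> divisor_excess as' bs' d = int (\<nu>' d)"
    using assms unfolding has_excess_def by blast
  show ?thesis
  proof
    assume rel: "(f, g) \<in> eta_power_rel"
    have "\<nu> d = \<nu>' d" for d
      using related_blocks_equal_excess[OF f(1) g(1) rel, of d] f(2,3) g(2,3) by (cases "d = 0") auto
    then show "\<nu> = \<nu>'" by blast
  next
    assume "\<nu> = \<nu>'"
    then show "(f, g) \<in> eta_power_rel"
      using blocks_with_equal_excess_related[OF f(1) g(1)] f(3) g(3) by simp
  qed
qed

text \<open>The support bound \<open>N\<close> comes from list entries, which may exceed
  \<open>K\<close> because large factors can cancel. The range up to \<open>max N K\<close>
  accommodates both.\<close>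

lemma weighted_compositions_iff:
  assumes "\<And>a. a > 0 \<Longrightarrow> c a \<ge> a" "\<And>a. a \<notin> {1..N} \<Longrightarrow> \<nu> a = 0"
  shows "\<nu> \<in> weighted_compositions c K K \<longleftrightarrow> (\<Sum>a=1..N. c a * \<nu> a) = K"
proof -
  have "\<nu> \<in> weighted_compositions c K K \<longleftrightarrow> \<nu> \<in> weighted_compositions c (max N K) K"
    using weighted_compositions_extend[of c K "max N K"] assms(1) by simp
  also have "\<dots> \<longleftrightarrow> (\<Sum>a=1..max N K. c a * \<nu> a) = K"
    using assms(2) by (auto simp: weighted_compositions_def)
  also have "(\<Sum>a=1..max N K. c a * \<nu> a) = (\<Sum>a=1..N. c a * \<nu> a)"
    using assms(2) by (intro sum.mono_neutral_right) auto
  finally show ?thesis .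
qed

lemma index_iff_weighted_composition:
  assumes data: "generalized_theta_block_data f n as bs" "\<nu> 0 = 0" "\<And>d. d > 0 \<Longrightarrow> divisor_excess as bs d = int (\<nu> d)"
  shows "2 * theta_block_index as bs = of_nat K \<longleftrightarrow> \<nu> \<in> weighted_compositions block_weight K K"
proof -
  have nz: "0 \<notin> set as" "0 \<notin> set bs"
    using data(1) by (simp_all add: generalized_theta_block_data_def)
  \<comment> \<open>Inserting 0 keeps \<open>Max\<close> meaningful when both lists are
    empty.\<close>
  define N where "N = Max (insert 0 ((nat \<circ> abs) ` (set as \<union> set bs)))"
  have N: "nat \<bar>a\<bar> \<le> N" if "a \<in> set as \<union> set bs" for a
    unfolding N_def using that by (intro Max_ge) auto
  have supp: "\<nu> a = 0" if a: "a \<notin> {1..N}" for a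
  proof (cases "a = 0")
    case False
    have "\<not> int a dvd x" if x: "x \<in> set as \<union> set bs" for x
    proof
      assume dvd: "int a dvd x"
      have "x \<noteq> 0" using x nz by auto
      from dvd_imp_le_int[OF this dvd] have "int a \<le> \<bar>x\<bar>" by simp
      then show False using N[OF x] a False by auto
    qed
    then have "filter (\<lambda>x. int a dvd x) as = []" "filter (\<lambda>x. int a dvd x) bs = []"
      by (auto simp: filter_empty_conv)
    then have "divisor_excess as bs a = 0"
      by (simp add: divisor_excess_def)
    then show ?thesis using data(3)[of a] False by simp
  qed (simp add: data(2))
  have "2 * theta_block_index as bs = of_int (\<Sum>d=1..N. int (block_weight d) * divisor_excess as bs d)"
    by (rule theta_block_index_conv_divisor_excess[OF nz N])
  also have "(\<Sum>d=1..N. int (block_weight d) * divisor_excess as bs d) = int (\<Sum>d=1..N. block_weight d * \<nu> d)"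
    unfolding of_nat_sum of_nat_mult by (intro sum.cong) (auto simp: data(3))
  finally have index: "2 * theta_block_index as bs = of_nat (\<Sum>d=1..N. block_weight d * \<nu> d)"
    by (simp only: of_int_of_nat_eq)
  have comp: "\<nu> \<in> weighted_compositions block_weight K K \<longleftrightarrow> (\<Sum>a=1..N. block_weight a * \<nu> a) = K"
    by (rule weighted_compositions_iff[where c = block_weight]) (use le_totient_dedekind_psi supp in blast)+
  show ?thesis
    unfolding index comp by (rule of_nat_eq_iff)
qed

lemma exists_block_of_weighted_composition:
  assumes "\<nu> \<in> weighted_compositions block_weight K K"
  shows "\<exists>f \<in> generalized_theta_blocks (of_nat K / 2). has_excess f \<nu>"
proof -
  have supp: "\<nu> d = 0" if "d \<notin> {1..K}" for d
    using assms that by (simp add: weighted_compositions_def)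
  then obtain as bs where ab: "0 \<notin> set as" "0 \<notin> set bs" "\<And>d. d > 0 \<Longrightarrow> divisor_excess as bs d = int (\<nu> d)"
    using exists_lists_with_divisor_excess[of K "\<lambda>d. int (\<nu> d)"] by auto
  define f where "f = (\<lambda>(\<tau>, z). theta_quotient as bs \<tau> z)"
  have data: "generalized_theta_block_data f 0 as bs"
    unfolding f_def using ab by (intro theta_quotient_block_data) auto
  have "\<nu> 0 = 0" using supp by simp
  from index_iff_weighted_composition[OF data this ab(3), of K] assms
  have "theta_block_index as bs = of_nat K / 2" by simp
  then have "f \<in> generalized_theta_blocks (of_nat K / 2)"
    using data unfolding generalized_theta_blocks_def by blast
  moreover have "has_excess f \<nu>"
    unfolding has_excess_def using data \<open>\<nu> 0 = 0\<close> ab(3) by blast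
  ultimately show ?thesis by blast
qed

lemma exists_weighted_composition_of_block:
  assumes "f \<in> generalized_theta_blocks (of_nat K / 2)"
  shows "\<exists>\<nu> \<in> weighted_compositions block_weight K K. has_excess f \<nu>"
proof -
  obtain n as bs where data: "generalized_theta_block_data f n as bs" and idx: "theta_block_index as bs = of_nat K / 2"
    using assms by (auto simp: generalized_theta_blocks_def)
  define \<nu> where "\<nu> d = (if d = 0 then 0 else nat (divisor_excess as bs d))" for d
  have \<nu>: "\<nu> 0 = 0" "\<And>d. d > 0 \<Longrightarrow> divisor_excess as bs d = int (\<nu> d)"
    using block_data_divisor_excess_nonneg[OF data] by (auto simp: \<nu>_def)
  from index_iff_weighted_composition[OF data \<nu>, of K] idx
  have "\<nu> \<in> weighted_compositions block_weight K K" by simp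
  moreover have "has_excess f \<nu>"
    unfolding has_excess_def using data \<nu> by blast
  ultimately show ?thesis by blast
qed

lemma theta_block_classes_card:
  "finite (generalized_theta_blocks (of_nat K / 2) // eta_power_rel)"
  "card (generalized_theta_blocks (of_nat K / 2) // eta_power_rel) = card (weighted_compositions block_weight K K)"
proof -
  let ?V = "weighted_compositions block_weight K K" and ?B = "generalized_theta_blocks (of_nat K / 2)"
  \<comment> \<open>Any block with excess \<nu> serves, since by
    \<open>has_excess_related_iff\<close> its class does not depend on the choice.\<close>
  define F where "F \<nu> = (SOME f. f \<in> ?B \<and> has_excess f \<nu>)" for \<nu>
  have F: "F \<nu> \<in> ?B \<and> has_excess (F \<nu>) \<nu>" if "\<nu> \<in> ?V" for \<nu>
  proof -
    have "\<exists>f. f \<in> ?B \<and> has_excess f \<nu>"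
      using exists_block_of_weighted_composition[OF that] by blast
    from someI_ex[OF this] show ?thesis by (simp only: F_def)
  qed
  have eq_iff: "eta_power_rel `` {f} = eta_power_rel `` {g} \<longleftrightarrow> (f, g) \<in> eta_power_rel" for f g
    using eq_equiv_class_iff[OF equiv_eta_power_rel] by simp
  have bij: "bij_betw (\<lambda>\<nu>. eta_power_rel `` {F \<nu>}) ?V (?B // eta_power_rel)"
  proof (rule bij_betw_imageI)
    show "inj_on (\<lambda>\<nu>. eta_power_rel `` {F \<nu>}) ?V"
    proof (rule inj_onI, unfold eq_iff)
      fix \<mu> \<nu> assume "\<mu> \<in> ?V" "\<nu> \<in> ?V" and rel: "(F \<mu>, F \<nu>) \<in> eta_power_rel"
      then have "has_excess (F \<mu>) \<mu>" "has_excess (F \<nu>) \<nu>" using F by blast+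
      from has_excess_related_iff[OF this] rel show "\<mu> = \<nu>" by simp
    qed
    show "(\<lambda>\<nu>. eta_power_rel `` {F \<nu>}) ` ?V = ?B // eta_power_rel"
    proof (intro equalityI subsetI)
      fix X assume "X \<in> ?B // eta_power_rel"
      then obtain f where f: "f \<in> ?B" "X = eta_power_rel `` {f}" by (auto elim: quotientE)
      obtain \<nu> where \<nu>: "\<nu> \<in> ?V" "has_excess f \<nu>"
        using exists_weighted_composition_of_block[OF f(1)] by blast
      have X_eq: "X = eta_power_rel `` {F \<nu>}"
        unfolding f(2) eq_iff using has_excess_related_iff[OF \<nu>(2), of "F \<nu>" \<nu>] F[OF \<nu>(1)] by simp
      show "X \<in> (\<lambda>\<nu>. eta_power_rel `` {F \<nu>}) ` ?V"
        using X_eq \<nu>(1) by (rule image_eqI)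
    next
      fix X assume "X \<in> (\<lambda>\<nu>. eta_power_rel `` {F \<nu>}) ` ?V"
      then obtain \<nu> where "X = eta_power_rel `` {F \<nu>}" "\<nu> \<in> ?V" by (rule imageE)
      then show "X \<in> ?B // eta_power_rel"
        using F[of \<nu>] by (simp add: quotientI)
    qed
  qed
  have "finite ?V"
  proof (rule finite_weighted_compositions)
    show "block_weight a > 0" if "a > 0" for a
      using le_totient_dedekind_psi[OF that] that by (rule less_le_trans[rotated])
  qed
  then show "finite (?B // eta_power_rel)"
    by (simp only: bij_betw_finite[OF bij])
  show "card (?B // eta_power_rel) = card ?V"
    by (simp only: bij_betw_same_card[OF bij])
qed

theorem theorem3p5:
  fixes m :: rat
  assumes "m > 0" and "2 * m \<in> \<int>"
  shows "finite (generalized_theta_blocks m // eta_power_rel) \<and>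
         of_nat (card (generalized_theta_blocks m // eta_power_rel)) =
           fps_nth (1 / (\<Prod>n. 1 - fps_X ^ (totient (Suc n) * dedekind_psi (Suc n))) :: rat fps)
             (nat \<lfloor>2 * m\<rfloor>)"
proof -
  \<comment> \<open>As \<open>2 * m\<close> is a positive integer the floor is exact, and
    \<open>m\<close> becomes \<open>of_nat K / 2\<close>, the form in which classes were
    counted.\<close>
  define K where "K = nat \<lfloor>2 * m\<rfloor>"
  from assms(2) obtain i where i: "2 * m = of_int i" by (rule Ints_cases)
  have "(of_int i :: rat) > 0" using assms(1) i by linarith
  then have "i > 0" by (simp only: of_int_0_less_iff)
  then have "of_nat (nat i) = (of_int i :: rat)" by (simp add: of_nat_nat)
  then have "of_nat K = 2 * m" unfolding K_def i by (simp only: floor_of_int)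
  then have m: "m = of_nat K / 2" by linarith
  have "fps_nth (1 / (\<Prod>n. 1 - fps_X ^ block_weight (Suc n)) :: rat fps) K =
      of_nat (card (weighted_compositions block_weight K K))"
    by (rule fps_nth_inverse_prodinf[of block_weight, OF le_totient_dedekind_psi])
  then show ?thesis
    using theta_block_classes_card[of K] unfolding K_def[symmetric] unfolding m by simp
qed

end
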